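(* Consider the regression model $y=X\beta+\epsilon$ with $\epsilon\sim\mathcal E_n(0,\sigma^2V,g)$, and the quadratic risk $R(\beta^*;\beta)=E[(\beta^*-\beta)'\mathbf W(\beta^*-\beta)]$ for a given positive definite $p\times p$ matrix $\mathbf W$. Let $q\ge3$, $m=n-p$, $d=\frac{(q-2)m}{q(m+2)}$ and $$\hat\beta^S=\tilde\beta-d\,\mathcal L_n^{-1}(\tilde\beta-\hat\beta).$$ If $$\frac{\mathrm{tr}(A_{11})}{ch_q(A_{11})}\ge\frac{q+2}{2},$$ where $ch_q(A_{11})$ is the maximum eigenvalue of $A_{11}$, then $R(\tilde\beta;\beta)-R(\hat\beta^S;\beta)>0$ for all $\beta\in\mathbb R^p$ and $\sigma>0$; that is, $\hat\beta^S$ uniformly dominates $\tilde\beta$.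
   Context: Model: $y=X\beta+\epsilon$, where $X$ is a fixed $n\times p$ matrix of full column rank $p<n$, $V$ is a known positive definite $n\times n$ matrix, $\beta\in\mathbb R^p$ and $\sigma>0$ are unknown, and $\epsilon\sim\mathcal E_n(0,\sigma^2V,g)$ has density $|\sigma^2V|^{-1/2}g(\epsilon'V^{-1}\epsilon/\sigma^2)$ of the form $$f_\epsilon(x)=\int_0^\infty \phi_{N_n(0,t^{-1}\sigma^2V)}(x)\,\mathcal W(dt),$$ where $\phi_{N_n(0,\Sigma)}$ is the density of $N_n(0,\Sigma)$ and $\mathcal W$ is a (possibly signed) measure on $(0,\infty)$, not depending on $\beta,\sigma$, with $\int_0^\infty\mathcal W(dt)=1$ and with Jordan decomposition $\mathcal W=\mathcal W^+-\mathcal W^-$ satisfying $\int t^{-1}\mathcal W^\pm(dt)<\infty$. Estimators: $C=X'V^{-1}X$; $\tilde\beta=C^{-1}X'V^{-1}y$; $S^2=(y-X\tilde\beta)'V^{-1}(y-X\tilde\beta)/(n-p)$; $H$ is a known $q\times p$ matrix of full row rank $q<p$, $h\in\mathbb R^q$ is known, $V_1=(HC^{-1}H')^{-1}$; $\hat\beta=\tilde\beta-C^{-1}H'V_1(H\tilde\beta-h)$ (restricted estimator); $\mathcal L_n=(H\tilde\beta-h)'V_1(H\tilde\beta-h)/(qS^2)$. The matrix $C^{-1/2}H'V_1HC^{-1/2}$ is a symmetric idempotent of rank $q$; $Q$ is an orthogonal matrix with $Q\,C^{-1/2}H'V_1HC^{-1/2}Q'=\begin{pmatrix}I_q&0\\0&0\end{pmatrix}$,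 and $A_{11}$ is the upper-left $q\times q$ block of $A=QC^{-1/2}\mathbf WC^{-1/2}Q'$. *)

theory Defs
  imports "HOL-Analysis.Analysis"
begin

text \<open>An \<open>n \<times> p\<close> matrix is a term of type \<^typ>\<open>real ^ 'p ^ 'n\<close>.\<close>

definition pos_def :: "real ^ 'n ^ 'n \<Rightarrow> bool" where
  "pos_def A \<longleftrightarrow> transpose A = A \<and> (\<forall>x. x \<noteq> 0 \<longrightarrow> x \<bullet> (A *v x) > 0)"

text \<open>\<open>is_inv_sqrt R C\<close>: \<open>R\<close> is \<open>C\<^sup>-\<^sup>1\<^sup>/\<^sup>2\<close>, the (unique) positive definite
  square root of the inverse of the positive definite matrix \<open>C\<close>.\<close>

definition is_inv_sqrt :: "real ^ 'n ^ 'n \<Rightarrow> real ^ 'n ^ 'n \<Rightarrow> bool" where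
  "is_inv_sqrt R C \<longleftrightarrow> pos_def R \<and> R ** R = matrix_inv C"

definition max_eigenvalue :: "real ^ 'n ^ 'n \<Rightarrow> real" where
  "max_eigenvalue A = Max {l. \<exists>v. v \<noteq> 0 \<and> A *v v = l *\<^sub>R v}"

text \<open>The index type \<open>'p\<close> carries no order, so "the first \<open>q\<close> coordinates" of \<open>\<real>\<^sup>p\<close>
  are designated by an injection \<open>\<iota> :: 'q \<Rightarrow> 'p\<close>: \<open>lead_id \<iota>\<close> is \<open>diag(I\<^sub>q, 0)\<close>, and
  \<open>lead_block \<iota> A\<close> is the upper-left \<open>q \<times> q\<close> block of \<open>A\<close>.\<close>

definition lead_id :: "('q \<Rightarrow> 'p) \<Rightarrow> real ^ 'p ^ 'p" where
  "lead_id \<iota> = (\<chi> i j. if i = j \<and> i \<in> range \<iota> then 1 else 0)"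

definition lead_block :: "('q \<Rightarrow> 'p) \<Rightarrow> real ^ 'p ^ 'p \<Rightarrow> real ^ 'q ^ 'q" where
  "lead_block \<iota> A = (\<chi> i j. A $ \<iota> i $ \<iota> j)"

definition mvn_density :: "real ^ 'n \<Rightarrow> real ^ 'n ^ 'n \<Rightarrow> real ^ 'n \<Rightarrow> real" where
  "mvn_density \<mu> \<Sigma> x =
     (2 * pi) powr (- real CARD('n) / 2) * det \<Sigma> powr (-1/2)
     * exp (- ((x - \<mu>) \<bullet> (matrix_inv \<Sigma> *v (x - \<mu>))) / 2)"

definition elliptical_density ::
  "real ^ 'n ^ 'n \<Rightarrow> real \<Rightarrow> (real \<Rightarrow> real) \<Rightarrow> real ^ 'n \<Rightarrow> real" where
  "elliptical_density V \<sigma> g x =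
     det (\<sigma>\<^sup>2 *\<^sub>R V) powr (-1/2) * g ((x \<bullet> (matrix_inv V *v x)) / \<sigma>\<^sup>2)"

text \<open>The law \<open>\<E>\<^sub>n(0, \<sigma>\<^sup>2 V, g)\<close>.\<close>

definition elliptical :: "real ^ 'n ^ 'n \<Rightarrow> real \<Rightarrow> (real \<Rightarrow> real) \<Rightarrow> (real ^ 'n) measure" where
  "elliptical V \<sigma> g = density lborel (\<lambda>x. ennreal (elliptical_density V \<sigma> g x))"

text \<open>A signed measure \<open>\<W>\<close> on \<open>(0,\<infinity>)\<close> is given by its Jordan decomposition
  \<open>\<W> = Wp - Wm\<close> into two mutually singular measures; both are finite because
  \<open>\<W>\<close> has finite total mass, namely 1.\<close>

definition signed_mixing :: "real measure \<Rightarrow> real measure \<Rightarrow> bool" where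
  "signed_mixing Wp Wm \<longleftrightarrow>
     finite_measure Wp \<and> finite_measure Wm \<and>
     sets Wp = sets (restrict_space borel {0<..}) \<and>
     sets Wm = sets (restrict_space borel {0<..}) \<and>
     (\<exists>P \<in> sets Wp. emeasure Wm P = 0 \<and> emeasure Wp ({0<..} - P) = 0) \<and>
     measure Wp {0<..} - measure Wm {0<..} = 1 \<and>
     integrable Wp (\<lambda>t. 1 / t) \<and> integrable Wm (\<lambda>t. 1 / t)"

text \<open>The mixture representation is required almost everywhere: at the origin the mixture
  integral may diverge (the normal density there is proportional to \<open>t\<^sup>n\<^sup>/\<^sup>2\<close>), and a density is
  determined only up to null sets.\<close>

definition normal_mixture ::
  "real ^ 'n ^ 'n \<Rightarrow> (real \<Rightarrow> real) \<Rightarrow> real measure \<Rightarrow> real measure \<Rightarrow> bool" where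
  "normal_mixture V g Wp Wm \<longleftrightarrow>
     (\<forall>\<sigma>>0. AE x in lborel. elliptical_density V \<sigma> g x =
        (\<integral>t. mvn_density 0 ((\<sigma>\<^sup>2 / t) *\<^sub>R V) x \<partial>Wp) -
        (\<integral>t. mvn_density 0 ((\<sigma>\<^sup>2 / t) *\<^sub>R V) x \<partial>Wm))"

definition gram :: "real ^ 'p ^ 'n \<Rightarrow> real ^ 'n ^ 'n \<Rightarrow> real ^ 'p ^ 'p" where
  "gram X V = transpose X ** matrix_inv V ** X"

definition beta_tilde :: "real ^ 'p ^ 'n \<Rightarrow> real ^ 'n ^ 'n \<Rightarrow> real ^ 'n \<Rightarrow> real ^ 'p" where
  "beta_tilde X V y = (matrix_inv (gram X V) ** transpose X ** matrix_inv V) *v y"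

definition S2 :: "real ^ 'p ^ 'n \<Rightarrow> real ^ 'n ^ 'n \<Rightarrow> real ^ 'n \<Rightarrow> real" where
  "S2 X V y = (let r = y - X *v beta_tilde X V y in
     (r \<bullet> (matrix_inv V *v r)) / (real CARD('n) - real CARD('p)))"

definition V1 :: "real ^ 'p ^ 'n \<Rightarrow> real ^ 'n ^ 'n \<Rightarrow> real ^ 'p ^ 'q \<Rightarrow> real ^ 'q ^ 'q" where
  "V1 X V H = matrix_inv (H ** matrix_inv (gram X V) ** transpose H)"

definition beta_hat ::
  "real ^ 'p ^ 'n \<Rightarrow> real ^ 'n ^ 'n \<Rightarrow> real ^ 'p ^ 'q \<Rightarrow> real ^ 'q \<Rightarrow> real ^ 'n \<Rightarrow> real ^ 'p" where
  "beta_hat X V H h y = beta_tilde X V y -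
     (matrix_inv (gram X V) ** transpose H ** V1 X V H) *v (H *v beta_tilde X V y - h)"

definition Ln ::
  "real ^ 'p ^ 'n \<Rightarrow> real ^ 'n ^ 'n \<Rightarrow> real ^ 'p ^ 'q \<Rightarrow> real ^ 'q \<Rightarrow> real ^ 'n \<Rightarrow> real" where
  "Ln X V H h y = (let r = H *v beta_tilde X V y - h in
     (r \<bullet> (V1 X V H *v r)) / (real CARD('q) * S2 X V y))"

definition beta_S ::
  "real \<Rightarrow> real ^ 'p ^ 'n \<Rightarrow> real ^ 'n ^ 'n \<Rightarrow> real ^ 'p ^ 'q \<Rightarrow> real ^ 'q \<Rightarrow> real ^ 'n \<Rightarrow> real ^ 'p" where
  "beta_S d X V H h y = beta_tilde X V y -
     (d * inverse (Ln X V H h y)) *\<^sub>R (beta_tilde X V y - beta_hat X V H h y)"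

definition quad_loss :: "real ^ 'p ^ 'p \<Rightarrow> real ^ 'p \<Rightarrow> real ^ 'p \<Rightarrow> real" where
  "quad_loss W b \<beta> = (b - \<beta>) \<bullet> (W *v (b - \<beta>))"

text \<open>An estimator \<open>est\<close> is a function of the observation \<open>y = X \<beta> + \<epsilon>\<close>. The Bochner integral of a
  non-integrable function is 0, so \<open>risk\<close> is meaningful only together with \<open>finite_risk\<close>.\<close>

definition finite_risk ::
  "real ^ 'p ^ 'p \<Rightarrow> real ^ 'p ^ 'n \<Rightarrow> real ^ 'n ^ 'n \<Rightarrow> (real \<Rightarrow> real) \<Rightarrow>
   (real ^ 'n \<Rightarrow> real ^ 'p) \<Rightarrow> real ^ 'p \<Rightarrow> real \<Rightarrow> bool" where
  "finite_risk W X V g est \<beta> \<sigma> \<longleftrightarrow>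
     integrable (elliptical V \<sigma> g) (\<lambda>\<epsilon>. quad_loss W (est (X *v \<beta> + \<epsilon>)) \<beta>)"

definition risk ::
  "real ^ 'p ^ 'p \<Rightarrow> real ^ 'p ^ 'n \<Rightarrow> real ^ 'n ^ 'n \<Rightarrow> (real \<Rightarrow> real) \<Rightarrow>
   (real ^ 'n \<Rightarrow> real ^ 'p) \<Rightarrow> real ^ 'p \<Rightarrow> real \<Rightarrow> real" where
  "risk W X V g est \<beta> \<sigma> = (\<integral>\<epsilon>. quad_loss W (est (X *v \<beta> + \<epsilon>)) \<beta> \<partial>elliptical V \<sigma> g)"

end

theory Submission
  imports Defs "HOL-Probability.Distributions"
begin

text \<open>Write \<open>r\<close> for the squared residual length, \<open>v\<close> for \<open>H \<beta>~ - h\<close>, \<open>ell = v \<bullet> V\<^sub>1 v\<close>. The risk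
  gain is the expectation of \<open>2c r s / ell - c\<^sup>2 r\<^sup>2 b / ell\<^sup>2\<close> with \<open>c = (q - 2) / (m + 2)\<close>, where \<open>s\<close> pairs
  the error with a linear field \<open>B v\<close> of mean directions and \<open>b\<close> is a quadratic form in \<open>v\<close>.
  For a centred normal error of any scale, integration by parts in the mean directions and then in the
  residual directions gives \<open>E[(m + 2) r s / ell] = E[r\<^sup>2 div (B v / ell)]\<close>, an identity that does not
  involve the scale. Being linear in the law, it holds for signed mixtures as well (the comparison of
  risks itself would not transfer). Under the elliptical law it rewrites the gain as the expectation of
  \<open>c / (m + 2) r\<^sup>2 / ell\<^sup>2\<close> times the quadratic form \<open>2 tr(A\<^sub>1\<^sub>1) |z|\<^sup>2 - (q + 2) z \<bullet> A\<^sub>1\<^sub>1 z\<close>, which is positive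
  semidefinite by the eigenvalue condition and nonzero because \<open>q > 2\<close>; positivity of the density concludes.
  Everything is done in the coordinates of the error vector, so no whitening is needed.\<close>

section \<open>Integration against Gaussian weights\<close>

text \<open>Two obstacles shape the proof. The field \<open>B v / ell\<close> is singular where
  \<open>ell\<close> vanishes, so integration by parts is done with \<open>ell + \<eta>\<close>. And
  Fubini for the mixture asks for bounds of order 1 / a in the Gaussian parameter a, matching the
  integrability of 1 / t under both parts of the mixing measure. Since \<open>v\<close> contains the
  shift \<open>v0\<close>, the quotient r^2 / ell is not homogeneous, and rescaling alone gives no
  such bound. The Stein identity for an auxiliary field \<open>B0\<close> gives it instead: q > 2
  makes the inverse moment finite, by a multiple of the second moment, and that one does scale. All
  integrands are then dominated by multiples of |x|^2 + r^2 / ell.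

  The residual directions serve to remove the scale: integration by parts in the mean directions
  alone leaves a factor 2 a, and the residual identity carries the same factor.

  The q + 2 of the eigenvalue condition is 4 + (q - 2): in units of c / (m + 2), the form b receives
  4 from twice the divergence and q - 2 from c^2 = (q - 2) c / (m + 2).\<close>

lemma integrable_lborel_translate:
  fixes f :: "'a::euclidean_space \<Rightarrow> real"
  assumes "integrable lborel f"
  shows "integrable lborel (\<lambda>x. f (x + c))"
proof -
  have "integrable (distr lborel borel ((+) c)) f"
    using assms by (simp add: lborel_distr_plus)
  then show ?thesis
    by (simp add: integrable_distr_eq borel_measurable_integrable[OF assms, simplified] add.commute)
qed

lemma integral_lborel_translate:
  fixes f :: "'a::euclidean_space \<Rightarrow> real"
  assumes "f \<in> borel_measurable borel"
  shows "(\<integral>x. f (x + c) \<partial>lborel) = (\<integral>x. f x \<partial>lborel)"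
proof -
  have "(\<integral>x. f x \<partial>lborel) = (\<integral>x. f x \<partial>distr lborel borel ((+) c))"
    by (simp add: lborel_distr_plus)
  also have "\<dots> = (\<integral>x. f (c + x) \<partial>lborel)"
    using assms by (subst integral_distr) auto
  finally show ?thesis by (simp add: add.commute)
qed

text \<open>Integrate \<open>F (x + a) - F x = \<integral>\<^sub>0\<^sup>1 D (x + s a) ds\<close> over \<open>x\<close>: by translation
  invariance the left side gives 0 and the right side \<open>\<integral> D\<close>, so no decay of \<open>F\<close> at infinity has to
  be quantified.\<close>

lemma integral_directional_derivative_eq_0:
  fixes F D :: "'a::euclidean_space \<Rightarrow> real"
  assumes der: "\<And>x. ((\<lambda>s. F (x + s *\<^sub>R a)) has_real_derivative D x) (at 0)"
    and cont: "continuous_on UNIV D"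
    and F: "integrable lborel F" and D: "integrable lborel D"
  shows "(\<integral>x. D x \<partial>lborel) = 0"
proof -
  have der': "((\<lambda>s. F (x + s *\<^sub>R a)) has_real_derivative D (x + t *\<^sub>R a)) (at t)" for x t
  proof -
    have "((\<lambda>s. F (x + (s + t) *\<^sub>R a)) has_real_derivative D (x + t *\<^sub>R a)) (at 0)"
      using der[of "x + t *\<^sub>R a"] by (simp add: algebra_simps)
    then show ?thesis using DERIV_at_within_shift[of "\<lambda>s. F (x + s *\<^sub>R a)" "D (x + t *\<^sub>R a)" t 0 UNIV]
      by (simp add: add.commute surj_plus)
  qed
  let ?f = "\<lambda>(s::real) x. indicator {0..1} s * D (x + s *\<^sub>R a)"
  have Dm: "D \<in> borel_measurable borel" using D borel_measurable_integrable by force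
  have Dcont: "continuous_on UNIV (\<lambda>s. D (x + s *\<^sub>R a))" for x
    by (rule continuous_on_compose2[OF cont]) (auto intro!: continuous_intros)
  have FTC: "(\<integral>s. ?f s x \<partial>lborel) = F (x + a) - F x" for x
  proof -
    have "(\<integral>s. D (x + s *\<^sub>R a) * indicator {0..1} s \<partial>lborel) = F (x + 1 *\<^sub>R a) - F (x + 0 *\<^sub>R a)"
      using der' Dcont
      by (intro integral_FTC_Icc_real) (auto simp: continuous_on_eq_continuous_at)
    then show ?thesis by (simp add: mult.commute)
  qed
  have int_x: "integrable lborel (\<lambda>x. ?f s x)" for s
    using integrable_lborel_translate[OF D] by auto
  \<comment> \<open>By translation invariance the inner absolute integral is the same for all s in
    [0,1], which gives joint integrability on the strip.\<close>
  have val: "(\<integral>x. norm (?f s x) \<partial>lborel) = indicator {0..1} s * (\<integral>x. \<bar>D x\<bar> \<partial>lborel)" for s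
    using integral_lborel_translate[of "\<lambda>x. \<bar>D x\<bar>" "s *\<^sub>R a"] Dm
    by (simp add: abs_mult)
  have meas: "case_prod ?f \<in> borel_measurable (lborel \<Otimes>\<^sub>M lborel)"
    using Dm by measurable
  have "integrable (lborel \<Otimes>\<^sub>M lborel) (case_prod ?f)"
  proof (rule lborel_pair.Fubini_integrable[OF meas])
    show "integrable lborel (\<lambda>x. LINT y|lborel. norm (case (x, y) of (s, x) \<Rightarrow> ?f s x))"
      unfolding prod.case val by (intro integrable_mult_left) auto
  qed (use int_x in auto)
  then have "(\<integral>x. (\<integral>s. ?f s x \<partial>lborel) \<partial>lborel) = (\<integral>s. (\<integral>x. ?f s x \<partial>lborel) \<partial>lborel)"
    by (rule lborel_pair.Fubini_integral)
  also have "(\<integral>s. (\<integral>x. ?f s x \<partial>lborel) \<partial>lborel) = (\<integral>s. indicator {0..1::real} s * (\<integral>x. D x \<partial>lborel) \<partial>lborel)"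
    using integral_lborel_translate[OF Dm] by simp
  also have "\<dots> = (\<integral>x. D x \<partial>lborel)" by simp
  finally have "(\<integral>x. D x \<partial>lborel) = (\<integral>x. F (x + a) - F x \<partial>lborel)" unfolding FTC by simp
  also have "\<dots> = 0"
    using F integral_lborel_translate[of F a] integrable_lborel_translate[OF F, of a]
    by (subst Bochner_Integration.integral_diff) (auto dest: borel_measurable_integrable)
  finally show ?thesis .
qed

text \<open>Closed under sums and products, and containing linear maps and regularized reciprocals,
  this class settles the continuity and integrability hypotheses of
  \<open>integral_directional_derivative_eq_0\<close> once a Gaussian weight is attached.\<close>

definition poly_bounded :: "('a::euclidean_space \<Rightarrow> real) \<Rightarrow> bool" where
  "poly_bounded f \<longleftrightarrow> continuous_on UNIV f \<and> (\<exists>C k. \<forall>x. \<bar>f x\<bar> \<le> C * (1 + norm x) ^ k)"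

lemma poly_boundedE:
  assumes "poly_bounded f"
  obtains C k where "C \<ge> 0" "\<And>x. \<bar>f x\<bar> \<le> C * (1 + norm x) ^ k"
proof -
  obtain C k where C: "\<And>x. \<bar>f x\<bar> \<le> C * (1 + norm x) ^ k"
    using assms unfolding poly_bounded_def by blast
  have "C \<ge> 0" using C[of 0] by simp
  with C show ?thesis using that by blast
qed

lemma poly_bounded_bounded:
  assumes "continuous_on UNIV f" "\<And>x. \<bar>f x\<bar> \<le> C"
  shows "poly_bounded f"
  unfolding poly_bounded_def using assms by (metis mult.right_neutral power_0)

lemma poly_bounded_const: "poly_bounded (\<lambda>_. c)"
  by (rule poly_bounded_bounded[of _ "\<bar>c\<bar>"]) auto

lemma poly_bounded_linear:
  assumes "linear f"
  shows "poly_bounded f"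
proof -
  have bl: "bounded_linear f" using assms by (simp add: linear_conv_bounded_linear)
  obtain K where K: "K \<ge> 0" "\<And>x. norm (f x) \<le> norm x * K" using bounded_linear.nonneg_bounded[OF bl] by blast
  have "\<bar>f x\<bar> \<le> K * (1 + norm x) ^ 1" for x
    using K(2)[of x] K(1) by (simp add: algebra_simps add_increasing)
  moreover have "continuous_on UNIV f" using bl by (simp add: linear_continuous_on)
  ultimately show ?thesis unfolding poly_bounded_def by blast
qed

lemma poly_bounded_add:
  assumes "poly_bounded f" "poly_bounded g"
  shows "poly_bounded (\<lambda>x. f x + g x)"
proof -
  obtain C k where C: "C \<ge> 0" "\<And>x. \<bar>f x\<bar> \<le> C * (1 + norm x) ^ k" using assms(1) poly_boundedE by blast
  obtain C' k' where C': "C' \<ge> 0" "\<And>x. \<bar>g x\<bar> \<le> C' * (1 + norm x) ^ k'" using assms(2) poly_boundedE by blast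
  have "\<bar>f x + g x\<bar> \<le> (C + C') * (1 + norm x) ^ (k + k')" for x
  proof -
    have "C * (1 + norm x) ^ k \<le> C * (1 + norm x) ^ (k + k')"
      "C' * (1 + norm x) ^ k' \<le> C' * (1 + norm x) ^ (k + k')"
      using C(1) C'(1) by (auto intro!: mult_left_mono power_increasing)
    then show ?thesis using C(2)[of x] C'(2)[of x] by (auto simp: algebra_simps)
  qed
  then show ?thesis using assms unfolding poly_bounded_def by (blast intro: continuous_on_add)
qed

lemma poly_bounded_mult:
  assumes "poly_bounded f" "poly_bounded g"
  shows "poly_bounded (\<lambda>x. f x * g x)"
proof -
  obtain C k where C: "C \<ge> 0" "\<And>x. \<bar>f x\<bar> \<le> C * (1 + norm x) ^ k" using assms(1) poly_boundedE by blast
  obtain C' k' where C': "C' \<ge> 0" "\<And>x. \<bar>g x\<bar> \<le> C' * (1 + norm x) ^ k'" using assms(2) poly_boundedE by blast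
  have "\<bar>f x * g x\<bar> \<le> (C * C') * (1 + norm x) ^ (k + k')" for x
    using mult_mono[OF C(2)[of x] C'(2)[of x]] C(1) by (simp add: abs_mult power_add mult_ac)
  then show ?thesis using assms unfolding poly_bounded_def by (blast intro: continuous_on_mult)
qed

lemma poly_bounded_minus: "poly_bounded f \<Longrightarrow> poly_bounded (\<lambda>x. - f x)"
  using poly_bounded_mult[OF poly_bounded_const[of "-1"]] by simp

lemma poly_bounded_diff: "poly_bounded f \<Longrightarrow> poly_bounded g \<Longrightarrow> poly_bounded (\<lambda>x. f x - g x)"
  using poly_bounded_add[OF _ poly_bounded_minus] by simp

lemma poly_bounded_power: "poly_bounded f \<Longrightarrow> poly_bounded (\<lambda>x. f x ^ k)"
  by (induction k) (auto intro: poly_bounded_const poly_bounded_mult)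

lemma poly_bounded_sum:
  "(\<And>i. i \<in> I \<Longrightarrow> poly_bounded (f i)) \<Longrightarrow> poly_bounded (\<lambda>x. \<Sum>i\<in>I. f i x)"
  by (induction I rule: infinite_finite_induct) (auto intro: poly_bounded_const poly_bounded_add)

lemma poly_bounded_affine_nth: "poly_bounded (\<lambda>x::real^'n. (c + A *v x) $ i)"
  unfolding vector_add_component
  by (intro poly_bounded_add poly_bounded_const poly_bounded_linear linearI)
     (auto simp: matrix_vector_right_distrib matrix_vector_mult_scaleR)

lemma poly_bounded_mult_nth: "poly_bounded (\<lambda>x::real^'n. (A *v x) $ i)"
  using poly_bounded_affine_nth[of 0 A i] by simp

lemma poly_bounded_inner:
  fixes f g :: "'a::euclidean_space \<Rightarrow> real^'m"
  assumes "\<And>i. poly_bounded (\<lambda>x. f x $ i)" "\<And>i. poly_bounded (\<lambda>x. g x $ i)"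
  shows "poly_bounded (\<lambda>x. f x \<bullet> g x)"
  unfolding inner_vec_def inner_real_def by (intro poly_bounded_sum poly_bounded_mult assms)

lemma poly_bounded_matrix_nth:
  fixes f :: "'a::euclidean_space \<Rightarrow> real^'m"
  assumes "\<And>i. poly_bounded (\<lambda>x. f x $ i)"
  shows "poly_bounded (\<lambda>x. (A *v f x) $ i)"
  unfolding matrix_vector_mult_def vec_lambda_beta
  by (intro poly_bounded_sum poly_bounded_mult poly_bounded_const assms)

lemma poly_bounded_inverse:
  fixes f :: "'a::euclidean_space \<Rightarrow> real"
  assumes "continuous_on UNIV f" "\<And>x. f x \<ge> \<eta>" "\<eta> > 0"
  shows "poly_bounded (\<lambda>x. inverse (f x))"
proof (rule poly_bounded_bounded[of _ "inverse \<eta>"])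
  show "continuous_on UNIV (\<lambda>x. inverse (f x))"
    using assms by (intro continuous_on_inverse) (auto, metis leD)
  show "\<bar>inverse (f x)\<bar> \<le> inverse \<eta>" for x
    using assms(2)[of x] assms(3) by (simp add: abs_if le_imp_inverse_le)
qed

section \<open>Gaussian integrability of functions of polynomial growth\<close>

lemma pos_def_lower_bound:
  fixes P :: "real^'n^'n"
  assumes "pos_def P"
  obtains c where "c > 0" "\<And>x. c * (norm x)\<^sup>2 \<le> x \<bullet> (P *v x)"
proof -
  let ?S = "sphere (0::real^'n) 1"
  have cont: "continuous_on ?S (\<lambda>x. x \<bullet> (P *v x))" by (intro continuous_intros matrix_vector_mult_linear_continuous_on)
  obtain u where u: "u \<in> ?S" "\<And>x. x \<in> ?S \<Longrightarrow> u \<bullet> (P *v u) \<le> x \<bullet> (P *v x)"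
    using continuous_attains_inf[OF compact_sphere _ cont] by auto
  show ?thesis
  proof (rule that[of "u \<bullet> (P *v u)"])
    show "u \<bullet> (P *v u) > 0" using assms u(1) unfolding pos_def_def by (metis mem_sphere_0 norm_zero zero_neq_one)
    fix x :: "real^'n"
    show "u \<bullet> (P *v u) * (norm x)\<^sup>2 \<le> x \<bullet> (P *v x)"
    proof (cases "x = 0")
      case False
      have "u \<bullet> (P *v u) \<le> (x /\<^sub>R norm x) \<bullet> (P *v (x /\<^sub>R norm x))" using u(2)[of "x /\<^sub>R norm x"] False by simp
      also have "\<dots> = (x \<bullet> (P *v x)) / (norm x)\<^sup>2"
        by (simp add: matrix_vector_mult_scaleR power2_eq_square divide_inverse)
      finally show ?thesis using False by (simp add: pos_le_divide_eq)
    qed simp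
  qed
qed

lemma integrable_exp_neg_norm_sq:
  assumes "c > 0"
  shows "integrable lborel (\<lambda>x::'a::euclidean_space. exp (- c * (norm x)\<^sup>2))"
proof -
  have 1: "integrable lborel (\<lambda>x::real. exp (- c * x\<^sup>2))"
  proof -
    \<comment> \<open>Variance 1 / (2 c), so that the exponent of the normal density is - c
      x^2.\<close>
    define s where "s = sqrt (1 / (2 * c))"
    have s: "s > 0" "2 * s\<^sup>2 = 1 / c" using assms by (auto simp: s_def)
    have "integrable lborel (\<lambda>x. normal_density 0 s x * (x - 0)^0)" by (rule integrable_normal_moment[OF s(1)])
    then have "integrable lborel (\<lambda>x. sqrt (2 * pi * s\<^sup>2) * normal_density 0 s x)"
      by (intro integrable_mult_right) simp
    moreover have "sqrt (2 * pi * s\<^sup>2) * normal_density 0 s x = exp (- c * x\<^sup>2)" for x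
      using s by (simp add: normal_density_def)
    ultimately show ?thesis by simp
  qed
  interpret product_sigma_finite "\<lambda>_::'a. lborel :: real measure" by standard
  have "integrable (\<Pi>\<^sub>M b\<in>(Basis::'a set). lborel) (\<lambda>x. \<Prod>b\<in>(Basis::'a set). exp (- c * (x b)\<^sup>2))"
    by (intro product_integrable_prod 1) simp
  moreover have "(\<Prod>b\<in>(Basis::'a set). exp (- c * (x b)\<^sup>2)) = exp (- c * (norm (\<Sum>b\<in>Basis. x b *\<^sub>R b))\<^sup>2)"
    for x :: "'a \<Rightarrow> real"
  proof -
    have "(norm (\<Sum>b\<in>Basis. x b *\<^sub>R b))\<^sup>2 = (\<Sum>b\<in>Basis. (x b)\<^sup>2)"
      unfolding power2_norm_eq_inner by (subst euclidean_inner) (simp add: power2_eq_square)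
    then show ?thesis by (simp add: sum_distrib_left flip: exp_sum sum_negf)
  qed
  ultimately have "integrable (\<Pi>\<^sub>M b\<in>(Basis::'a set). lborel)
      (\<lambda>x. exp (- c * (norm (\<Sum>b\<in>(Basis::'a set). x b *\<^sub>R b))\<^sup>2))" by simp
  then show ?thesis
    by (subst lborel_eq, subst integrable_distr_eq) auto
qed

lemma poly_bounded_integrable_gaussian:
  fixes P :: "real^'n^'n"
  assumes "poly_bounded f" "pos_def P" "a > 0"
  shows "integrable lborel (\<lambda>x. f x * exp (- a * (x \<bullet> (P *v x))))"
proof -
  obtain C k where C: "C \<ge> 0" "\<And>x. \<bar>f x\<bar> \<le> C * (1 + norm x) ^ k" using assms(1) poly_boundedE by blast
  obtain c where c: "c > 0" "\<And>x. c * (norm x)\<^sup>2 \<le> x \<bullet> (P *v x)" using pos_def_lower_bound[OF assms(2)] by blast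
  \<comment> \<open>Half of the decay rate a * c absorbs the polynomial factor, through exp (k |x|)
    and a completed square whose remainder enters \<open>K\<close>; the other half is left for
    integrability.\<close>
  define b where "b = a * c / 2"
  have b: "b > 0" using assms c by (simp add: b_def)
  define K where "K = C * exp ((real k)\<^sup>2 / (4 * b))"
  have cont: "continuous_on UNIV (\<lambda>x. f x * exp (- a * (x \<bullet> (P *v x))))"
    using assms(1) unfolding poly_bounded_def
    by (intro continuous_intros matrix_vector_mult_linear_continuous_on) auto
  have bound: "\<bar>f x * exp (- a * (x \<bullet> (P *v x)))\<bar> \<le> K * exp (- b * (norm x)\<^sup>2)" for x
  proof -
    have "(1 + norm x) ^ k \<le> exp (norm x) ^ k" by (intro power_mono) auto
    also have "\<dots> = exp (real k * norm x)" by (simp add: exp_of_nat_mult)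
    also have "\<dots> \<le> exp ((real k)\<^sup>2 / (4 * b) + b * (norm x)\<^sup>2)"
    proof -
      have "0 \<le> (real k - 2 * b * norm x)\<^sup>2 / (4 * b)" using b by simp
      also have "\<dots> = (real k)\<^sup>2 / (4 * b) + b * (norm x)\<^sup>2 - real k * norm x"
        using b by (simp add: power2_eq_square field_simps)
      finally show ?thesis by simp
    qed
    finally have 1: "C * (1 + norm x) ^ k \<le> K * exp (b * (norm x)\<^sup>2)"
      using C(1) unfolding K_def exp_add by (simp add: mult.assoc mult_left_mono)
    have "exp (- a * (x \<bullet> (P *v x))) \<le> exp (- 2 * b * (norm x)\<^sup>2)"
      using c(2)[of x] assms(3) by (simp add: b_def mult.assoc)
    then have "\<bar>f x * exp (- a * (x \<bullet> (P *v x)))\<bar> \<le> K * exp (b * (norm x)\<^sup>2) * exp (- 2 * b * (norm x)\<^sup>2)"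
      unfolding abs_mult using C(2)[of x] 1
      by (intro mult_mono) (auto intro: order_trans)
    also have "\<dots> = K * exp (- b * (norm x)\<^sup>2)" by (simp add: mult.assoc flip: exp_add)
    finally show ?thesis .
  qed
  show ?thesis
  proof (rule Bochner_Integration.integrable_bound)
    show "integrable lborel (\<lambda>x::real^'n. K * exp (- b * (norm x)\<^sup>2))"
      by (intro integrable_mult_right integrable_exp_neg_norm_sq b)
    show "(\<lambda>x. f x * exp (- a * (x \<bullet> (P *v x)))) \<in> borel_measurable lborel"
      using borel_measurable_continuous_onI[OF cont] by simp
    show "AE x in lborel. norm (f x * exp (- a * (x \<bullet> (P *v x)))) \<le> norm (K * exp (- b * (norm x)\<^sup>2))"
      using bound by (intro AE_I2) (metis abs_ge_self order_trans real_norm_def)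
  qed
qed

section \<open>The Stein identity\<close>

lemma quad_form_has_derivative:
  fixes A :: "real^'k^'k"
  assumes "transpose A = A"
  shows "((\<lambda>s. (y + s *\<^sub>R w) \<bullet> (A *v (y + s *\<^sub>R w))) has_real_derivative 2 * (w \<bullet> (A *v y))) (at 0)"
proof -
  have "y \<bullet> (A *v w) = w \<bullet> (A *v y)"
    using assms by (metis dot_lmul_matrix inner_commute transpose_matrix_vector)
  then have "(y + s *\<^sub>R w) \<bullet> (A *v (y + s *\<^sub>R w))
      = y \<bullet> (A *v y) + s * (2 * (w \<bullet> (A *v y))) + s\<^sup>2 * (w \<bullet> (A *v w))" for s
    by (simp add: matrix_vector_right_distrib matrix_vector_mult_scaleR inner_add_left inner_add_right
        power2_eq_square algebra_simps)
  then show ?thesis by (auto intro!: derivative_eq_intros)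
qed

lemma sum_axis_scaleR: "(\<Sum>i\<in>UNIV. (z $ i) *\<^sub>R (A *v axis i 1)) = A *v (z :: real^'k)"
  by (simp add: matrix_mult_sum[of A z] scalar_mult_eq_scaleR matrix_vector_mult_basis)

text \<open>One nonzero row of \<open>M\<close> already confines the preimage to a
  hyperplane.\<close>

lemma negligible_affine_preimage:
  fixes M :: "real^'n^'m"
  assumes "M \<noteq> 0"
  shows "negligible {x. M *v x = c}"
proof -
  obtain i where i: "row i M \<noteq> 0"
    using assms by (auto simp: row_def vec_eq_iff)
  have "{x. M *v x = c} \<subseteq> {x. row i M \<bullet> x = c $ i}"
    by (auto simp: matrix_vector_mult_def row_def inner_vec_def)
  then show ?thesis
    by (rule negligible_subset[rotated]) (intro negligible_hyperplane disjI1 i)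
qed

lemma AE_not_affine_preimage:
  fixes M :: "real^'n^'m"
  assumes "M \<noteq> 0"
  shows "AE x in lborel. M *v x \<noteq> c"
proof -
  have cl: "closed {x. M *v x = c}"
    by (intro closed_Collect_eq continuous_intros matrix_vector_mult_linear_continuous_on)
  have "{x. M *v x = c} \<in> null_sets lborel"
    using negligible_affine_preimage[OF assms, of c] cl
    by (metis borel_closed negligible_iff_null_sets null_sets_completion_iff sets_lborel)
  then show ?thesis by (auto dest: AE_not_in)
qed

text \<open>In the application \<open>N\<close> is the residual projection \<open>1 - X T\<close> with \<open>T\<close> the matrix of \<open>\<beta>~\<close>, \<open>L = H T\<close>,
  \<open>U = V\<^sub>1\<close>, and \<open>v0 = H \<beta> - h\<close>; the argument \<open>x\<close> of the functions below is the error vector.\<close>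

locale shrinkage =
  fixes P N :: "real^'n^'n" and v0 :: "real^'q" and L :: "real^'n^'q" and U :: "real^'q^'q"
    and B0 :: "real^'q^'n"
  assumes P: "pos_def P" and U: "pos_def U"
    and N_idem: "N ** N = N" and LN: "L ** N = 0"
    and NP: "transpose N ** P ** N = transpose N ** P"
    and NB0: "N ** B0 = 0" and LB0: "L ** B0 = mat 1"
    and q3: "CARD('q) \<ge> 3"
begin

definition "v x = v0 + L *v x"
definition "ell x = v x \<bullet> (U *v v x)"
definition "r x = (N *v x) \<bullet> (P *v (N *v x))"
definition "gw a x = exp (- a * (x \<bullet> (P *v x)))"
text \<open>For the \<open>B\<close> of the theorem, \<open>s B\<close> is the cross term of the
  loss and \<open>bil B\<close> the loss of the shrinkage direction. \<open>B\<close> stays a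
  parameter because the Stein identity is also applied to \<open>B0\<close>, for which
  \<open>bil B0 = ell\<close> and \<open>trace (L ** B0)\<close> is q.\<close>

definition "s B x = (B *v v x) \<bullet> (P *v x)"
definition "bil B x = (U *v v x) \<bullet> (L *v (B *v v x))"

abbreviation "m \<equiv> trace N"

section \<open>Growth and directional derivatives of the basic functions\<close>

lemma P_sym: "transpose P = P" and U_sym: "transpose U = U"
  using P U by (auto simp: pos_def_def)

text \<open>\<open>NP\<close> expresses that \<open>N\<close> is the projection orthogonal for the
  inner product of \<open>P\<close>, so pairing \<open>N *v x\<close> with \<open>P *v x\<close>
  sees only the residual part of x. This identifies the derivative of the Gaussian weight along
  \<open>N *v x\<close> with a multiple of \<open>r\<close>.\<close>

lemma r_altdef: "(N *v x) \<bullet> (P *v x) = r x"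
proof -
  have "(N *v x) \<bullet> (P *v y) = x \<bullet> ((transpose N ** P) *v y)" for y
    by (simp flip: matrix_vector_mul_assoc add: dot_lmul_matrix inner_commute)
       (metis dot_lmul_matrix inner_commute transpose_matrix_vector transpose_transpose)
  note * = this
  show ?thesis unfolding r_def * by (metis NP matrix_vector_mul_assoc)
qed

lemma ell_nonneg: "ell x \<ge> 0"
  using U unfolding ell_def pos_def_def by (metis inner_zero_left less_eq_real_def)

lemma ell_eq_0: "ell x = 0 \<longleftrightarrow> v x = 0"
  using U unfolding ell_def pos_def_def by (metis inner_zero_left less_irrefl)

lemma pb_v: "poly_bounded (\<lambda>x. v x $ i)"
  unfolding v_def by (rule poly_bounded_affine_nth)

lemma pb_ell: "poly_bounded ell"
  unfolding ell_def by (intro poly_bounded_inner poly_bounded_matrix_nth pb_v)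

lemma pb_r: "poly_bounded r"
  unfolding r_def by (intro poly_bounded_inner poly_bounded_matrix_nth poly_bounded_mult_nth)

lemma pb_s: "poly_bounded (s B)"
  unfolding s_def by (intro poly_bounded_inner poly_bounded_matrix_nth poly_bounded_mult_nth pb_v)

lemma pb_bil: "poly_bounded (bil B)"
  unfolding bil_def by (intro poly_bounded_inner poly_bounded_matrix_nth poly_bounded_mult_nth pb_v)

lemma pb_inv: "\<eta> > 0 \<Longrightarrow> poly_bounded (\<lambda>x. inverse (ell x + \<eta>))"
  using pb_ell ell_nonneg unfolding poly_bounded_def
  by (intro poly_bounded_inverse[unfolded poly_bounded_def, of _ \<eta>]) (auto intro!: continuous_intros)

lemma gaussian_integrable: "poly_bounded f \<Longrightarrow> a > 0 \<Longrightarrow> integrable lborel (\<lambda>x. f x * gw a x)"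
  unfolding gw_def by (rule poly_bounded_integrable_gaussian[OF _ P])

lemma continuous_gaussian: "poly_bounded f \<Longrightarrow> continuous_on UNIV (\<lambda>x. f x * gw a x)"
  unfolding gw_def poly_bounded_def
  by (intro continuous_intros matrix_vector_mult_linear_continuous_on) auto

lemma v_shift: "v (x + t *\<^sub>R w) = v x + t *\<^sub>R (L *v w)"
  by (simp add: v_def matrix_vector_right_distrib matrix_vector_mult_scaleR)

lemma v_has_derivative: "((\<lambda>t. v (x + t *\<^sub>R w) $ i) has_real_derivative (L *v w) $ i) (at 0)"
  unfolding v_shift by (auto intro!: derivative_eq_intros)

lemma ell_has_derivative:
  "((\<lambda>t. ell (x + t *\<^sub>R w)) has_real_derivative 2 * ((L *v w) \<bullet> (U *v v x))) (at 0)"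
  unfolding ell_def v_shift by (rule quad_form_has_derivative[OF U_sym])

lemma r_has_derivative:
  "((\<lambda>t. r (x + t *\<^sub>R w)) has_real_derivative 2 * ((N *v w) \<bullet> (P *v (N *v x)))) (at 0)"
  unfolding r_def matrix_vector_right_distrib matrix_vector_mult_scaleR
  using quad_form_has_derivative[OF P_sym, of "N *v x" "N *v w"]
  by (simp add: matrix_vector_right_distrib matrix_vector_mult_scaleR)

lemma gw_has_derivative:
  "((\<lambda>t. gw a (x + t *\<^sub>R w)) has_real_derivative - 2 * a * (w \<bullet> (P *v x)) * gw a x) (at 0)"
  unfolding gw_def
  by (rule derivative_eq_intros quad_form_has_derivative[OF P_sym] refl | simp)+

lemma v_N: "v (x + t *\<^sub>R (N *v y)) = v x"
  using LN by (simp add: v_shift matrix_vector_mul_assoc)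

text \<open>Divergence theorem for the field r \<psi> N x against the weight. The divergence of N x
  is \<open>m\<close>, the quadratic form \<open>r\<close> contributes 2 r along N x, the weight
  contributes - 2 a r, and \<psi> is constant in residual directions. For \<psi> = 1 this is the
  recursion between the first two moments of a scaled chi-square variable.\<close>

lemma stein_residual:
  assumes \<psi>: "poly_bounded \<psi>" and inv: "\<And>x y t. \<psi> (x + t *\<^sub>R (N *v y)) = \<psi> x" and a: "a > 0"
  shows "(m + 2) * (\<integral>x. r x * \<psi> x * gw a x \<partial>lborel) = 2 * a * (\<integral>x. (r x)\<^sup>2 * \<psi> x * gw a x \<partial>lborel)"
proof -
  let ?w = "\<lambda>j. N *v axis j 1"
  \<comment> \<open>Derivative of the j-th coordinate of the field along the j-th column of
    \<open>N\<close>. Since \<open>N\<close> is idempotent, summing over j gives the divergence with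
    coefficient \<open>trace N\<close> and differentiation along N x itself.\<close>
  define D where "D j x = (N $ j $ j * r x + (N *v x) $ j * (2 * (?w j \<bullet> (P *v (N *v x))))
      + (N *v x) $ j * r x * (- 2 * a * (?w j \<bullet> (P *v x)))) * \<psi> x * gw a x" for j x
  have NN: "N *v (N *v x) = N *v x" for x by (simp add: matrix_vector_mul_assoc N_idem)
  have pbD: "poly_bounded (\<lambda>x. (N $ j $ j * r x + (N *v x) $ j * (2 * (?w j \<bullet> (P *v (N *v x))))
      + (N *v x) $ j * r x * (- 2 * a * (?w j \<bullet> (P *v x)))) * \<psi> x)" for j
    by (intro poly_bounded_mult poly_bounded_add poly_bounded_const pb_r \<psi> poly_bounded_inner
        poly_bounded_matrix_nth poly_bounded_mult_nth)
  have D0: "(\<integral>x. D j x \<partial>lborel) = 0" and Dint: "integrable lborel (D j)" for j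
  proof -
    show *: "integrable lborel (D j)"
      unfolding D_def by (rule gaussian_integrable[OF pbD a])
    show "(\<integral>x. D j x \<partial>lborel) = 0"
    proof (rule integral_directional_derivative_eq_0[OF _ _ _ *])
      show "continuous_on UNIV (D j)" unfolding D_def by (rule continuous_gaussian[OF pbD])
      show "integrable lborel (\<lambda>x. ((N *v x) $ j * r x * \<psi> x) * gw a x)"
        by (intro gaussian_integrable poly_bounded_mult pb_r \<psi> poly_bounded_mult_nth a)
      fix x
      have "((\<lambda>t. (N *v (x + t *\<^sub>R ?w j)) $ j) has_real_derivative N $ j $ j) (at 0)"
        unfolding matrix_vector_right_distrib matrix_vector_mult_scaleR NN
        by (auto intro!: derivative_eq_intros simp: matrix_vector_mult_basis column_def)
      then have "((\<lambda>t. ((N *v (x + t *\<^sub>R ?w j)) $ j * r (x + t *\<^sub>R ?w j) * \<psi> x) * gw a (x + t *\<^sub>R ?w j))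
          has_real_derivative D j x) (at 0)"
        unfolding D_def
        by (rule DERIV_cong[OF DERIV_mult[OF DERIV_mult[OF DERIV_mult[OF _ r_has_derivative] DERIV_const] gw_has_derivative]])
           (simp add: NN algebra_simps)
      then show "((\<lambda>t. ((N *v (x + t *\<^sub>R ?w j)) $ j * r (x + t *\<^sub>R ?w j) * \<psi> (x + t *\<^sub>R ?w j)) * gw a (x + t *\<^sub>R ?w j))
          has_real_derivative D j x) (at 0)"
        by (simp add: inv)
    qed
  qed
  have sumD: "(\<Sum>j\<in>UNIV. D j x) = (m + 2) * (r x * \<psi> x * gw a x) - 2 * a * ((r x)\<^sup>2 * \<psi> x * gw a x)" for x
  proof -
    have 1: "(\<Sum>j\<in>UNIV. (N *v x) $ j * (?w j \<bullet> z)) = (N *v x) \<bullet> z" for z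
      using arg_cong[OF sum_axis_scaleR[of "N *v x" N], of "\<lambda>y. y \<bullet> z"]
      by (simp add: NN inner_sum_left)
    have "(\<Sum>j\<in>UNIV. D j x) = ((\<Sum>j\<in>UNIV. N $ j $ j) * r x + 2 * (\<Sum>j\<in>UNIV. (N *v x) $ j * (?w j \<bullet> (P *v (N *v x))))
      - 2 * a * r x * (\<Sum>j\<in>UNIV. (N *v x) $ j * (?w j \<bullet> (P *v x)))) * \<psi> x * gw a x"
      unfolding D_def
      by (simp add: sum_distrib_right sum_distrib_left sum.distrib sum_subtractf algebra_simps sum_negf)
    also have "\<dots> = (m * r x + 2 * r x - 2 * a * r x * r x) * \<psi> x * gw a x"
      unfolding 1 r_altdef by (simp add: trace_def r_def)
    finally show ?thesis by (simp add: algebra_simps power2_eq_square)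
  qed
  have "0 = (\<integral>x. (\<Sum>j\<in>UNIV. D j x) \<partial>lborel)"
    using D0 Dint by (simp add: Bochner_Integration.integral_sum)
  also have "\<dots> = (m + 2) * (\<integral>x. r x * \<psi> x * gw a x \<partial>lborel) - 2 * a * (\<integral>x. (r x)\<^sup>2 * \<psi> x * gw a x \<partial>lborel)"
    unfolding sumD
    by (subst Bochner_Integration.integral_diff)
       (auto intro!: integrable_mult_right gaussian_integrable poly_bounded_mult poly_bounded_power pb_r \<psi> a)
  finally show ?thesis by simp
qed

text \<open>The divergence of the smooth field B v / (ell + \<eta>).\<close>

definition "D \<eta> B x = trace (L ** B) * inverse (ell x + \<eta>) - 2 * bil B x * (inverse (ell x + \<eta>))\<^sup>2"

lemma pb_D: "\<eta> > 0 \<Longrightarrow> poly_bounded (D \<eta> B)"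
  unfolding D_def by (intro poly_bounded_diff poly_bounded_mult poly_bounded_const pb_bil pb_inv poly_bounded_power)

text \<open>\<open>NB\<close> makes \<open>r\<close> constant along the columns of \<open>B\<close>,
  so only the field and the weight are differentiated. The sum over i assembles the derivatives of
  v_i / (ell + \<eta>) along the i-th column into the divergence.\<close>

lemma stein_mean:
  assumes NB: "N ** B = 0" and \<eta>: "\<eta> > 0" and a: "a > 0"
  shows "(\<integral>x. r x * D \<eta> B x * gw a x \<partial>lborel)
    = 2 * a * (\<integral>x. (r x * s B x * inverse (ell x + \<eta>)) * gw a x \<partial>lborel)"
proof -
  let ?w = "\<lambda>i. B *v axis i 1"
  let ?g = "\<lambda>x. inverse (ell x + \<eta>)"
  define E where "E i x = (((L *v ?w i) $ i * ?g x - v x $ i * (2 * ((L *v ?w i) \<bullet> (U *v v x))) * (?g x)\<^sup>2) * r x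
      + v x $ i * ?g x * r x * (- 2 * a * (?w i \<bullet> (P *v x)))) * gw a x" for i x
  have NB': "N *v (B *v x) = 0" for x by (simp add: matrix_vector_mul_assoc NB)
  have pbE: "poly_bounded (\<lambda>x. ((L *v ?w i) $ i * ?g x - v x $ i * (2 * ((L *v ?w i) \<bullet> (U *v v x))) * (?g x)\<^sup>2) * r x
      + v x $ i * ?g x * r x * (- 2 * a * (?w i \<bullet> (P *v x))))" for i
    by (intro poly_bounded_mult poly_bounded_add poly_bounded_diff poly_bounded_const pb_r poly_bounded_inner
        poly_bounded_matrix_nth poly_bounded_mult_nth pb_v pb_inv \<eta> poly_bounded_power)
  have nz: "ell x + \<eta> \<noteq> 0" for x using ell_nonneg[of x] \<eta> by linarith
  have E0: "(\<integral>x. E i x \<partial>lborel) = 0" and Eint: "integrable lborel (E i)" for i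
  proof -
    show *: "integrable lborel (E i)"
      unfolding E_def by (rule gaussian_integrable[OF pbE a])
    show "(\<integral>x. E i x \<partial>lborel) = 0"
    proof (rule integral_directional_derivative_eq_0[OF _ _ _ *])
      show "continuous_on UNIV (E i)" unfolding E_def by (rule continuous_gaussian[OF pbE])
      show "integrable lborel (\<lambda>x. (v x $ i * ?g x * r x) * gw a x)"
        by (intro gaussian_integrable poly_bounded_mult pb_r pb_v pb_inv a \<eta>)
      fix x
      have "((\<lambda>t. ?g (x + t *\<^sub>R ?w i)) has_real_derivative - (2 * ((L *v ?w i) \<bullet> (U *v v x)) * (?g x)\<^sup>2)) (at 0)"
        using nz[of x] by (auto intro!: derivative_eq_intros ell_has_derivative simp: power2_eq_square)
      then show "((\<lambda>t. (v (x + t *\<^sub>R ?w i) $ i * ?g (x + t *\<^sub>R ?w i) * r (x + t *\<^sub>R ?w i)) * gw a (x + t *\<^sub>R ?w i))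
          has_real_derivative E i x) (at 0)"
        unfolding E_def
        by (rule DERIV_cong[OF DERIV_mult[OF DERIV_mult[OF DERIV_mult[OF v_has_derivative] r_has_derivative] gw_has_derivative]])
           (simp add: NB' algebra_simps)
    qed
  qed
  have sumE: "(\<Sum>i\<in>UNIV. E i x) = r x * D \<eta> B x * gw a x - 2 * a * (r x * s B x * ?g x * gw a x)" for x
  proof -
    have 1: "(\<Sum>i\<in>UNIV. v x $ i * (?w i \<bullet> z)) = (B *v v x) \<bullet> z" for z
      using arg_cong[OF sum_axis_scaleR[of "v x" B], of "\<lambda>y. y \<bullet> z"]
      by (simp add: inner_sum_left)
    have 2: "(\<Sum>i\<in>UNIV. v x $ i * ((L *v ?w i) \<bullet> z)) = (L *v (B *v v x)) \<bullet> z" for z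
      using arg_cong[OF sum_axis_scaleR[of "v x" "L ** B"], of "\<lambda>y. y \<bullet> z"]
      by (simp add: inner_sum_left matrix_vector_mul_assoc)
    have 3: "(\<Sum>i\<in>UNIV. (L *v ?w i) $ i) = trace (L ** B)"
      unfolding matrix_vector_mul_assoc trace_def by (simp add: matrix_vector_mult_basis column_def)
    have "(\<Sum>i\<in>UNIV. E i x) = (((\<Sum>i\<in>UNIV. (L *v ?w i) $ i) * ?g x
        - 2 * (\<Sum>i\<in>UNIV. v x $ i * ((L *v ?w i) \<bullet> (U *v v x))) * (?g x)\<^sup>2) * r x
      - 2 * a * ?g x * r x * (\<Sum>i\<in>UNIV. v x $ i * (?w i \<bullet> (P *v x)))) * gw a x"
      unfolding E_def
      by (simp add: sum_distrib_right sum_distrib_left sum.distrib sum_subtractf algebra_simps sum_negf)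
    also have "\<dots> = ((trace (L ** B) * ?g x - 2 * bil B x * (?g x)\<^sup>2) * r x - 2 * a * ?g x * r x * s B x) * gw a x"
      unfolding 1 2 3 by (simp add: bil_def s_def inner_commute)
    finally show ?thesis by (simp add: D_def algebra_simps power2_eq_square)
  qed
  have "0 = (\<integral>x. (\<Sum>i\<in>UNIV. E i x) \<partial>lborel)"
    using E0 Eint by (simp add: Bochner_Integration.integral_sum)
  also have "\<dots> = (\<integral>x. r x * D \<eta> B x * gw a x \<partial>lborel) - 2 * a * (\<integral>x. (r x * s B x * ?g x) * gw a x \<partial>lborel)"
    unfolding sumE
    by (subst Bochner_Integration.integral_diff)
       (auto intro!: integrable_mult_right gaussian_integrable poly_bounded_mult pb_s pb_r pb_D pb_inv a \<eta>)
  finally show ?thesis by simp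
qed

text \<open>\<open>D \<eta> B\<close> depends on x only through \<open>v\<close>, so it is
  admissible as \<psi> in \<open>stein_residual\<close>. Combined with \<open>stein_mean\<close>
  multiplied by m + 2, both sides carry the factor 2 a, which cancels: the remaining integrand is
  the same for every a.\<close>

lemma stein_regularized:
  assumes NB: "N ** B = 0" and \<eta>: "\<eta> > 0" and a: "a > 0"
  shows "(\<integral>x. ((m + 2) * (r x * s B x * inverse (ell x + \<eta>)) - (r x)\<^sup>2 * D \<eta> B x) * gw a x \<partial>lborel) = 0"
    and "integrable lborel (\<lambda>x. ((m + 2) * (r x * s B x * inverse (ell x + \<eta>)) - (r x)\<^sup>2 * D \<eta> B x) * gw a x)"
proof -
  have i: "integrable lborel (\<lambda>x. (r x * s B x * inverse (ell x + \<eta>)) * gw a x)"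
    "integrable lborel (\<lambda>x. ((r x)\<^sup>2 * D \<eta> B x) * gw a x)"
    by (intro gaussian_integrable poly_bounded_mult poly_bounded_power pb_s pb_r pb_D pb_inv a \<eta>)+
  have "2 * a * ((m + 2) * (\<integral>x. (r x * s B x * inverse (ell x + \<eta>)) * gw a x \<partial>lborel))
      = 2 * a * (\<integral>x. ((r x)\<^sup>2 * D \<eta> B x) * gw a x \<partial>lborel)"
    using stein_residual[OF pb_D[OF \<eta>, of B] _ a] stein_mean[OF NB \<eta> a]
    by (simp add: D_def ell_def bil_def v_N mult_ac)
  then have "(m + 2) * (\<integral>x. (r x * s B x * inverse (ell x + \<eta>)) * gw a x \<partial>lborel)
      = (\<integral>x. ((r x)\<^sup>2 * D \<eta> B x) * gw a x \<partial>lborel)" using a by simp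
  moreover have eq: "((m + 2) * (r x * s B x * inverse (ell x + \<eta>)) - (r x)\<^sup>2 * D \<eta> B x) * gw a x
      = (m + 2) * ((r x * s B x * inverse (ell x + \<eta>)) * gw a x) - ((r x)\<^sup>2 * D \<eta> B x) * gw a x" for x
    by (simp add: algebra_simps)
  ultimately show "(\<integral>x. ((m + 2) * (r x * s B x * inverse (ell x + \<eta>)) - (r x)\<^sup>2 * D \<eta> B x) * gw a x \<partial>lborel) = 0"
    unfolding eq using i by (subst Bochner_Integration.integral_diff) auto
  show "integrable lborel (\<lambda>x. ((m + 2) * (r x * s B x * inverse (ell x + \<eta>)) - (r x)\<^sup>2 * D \<eta> B x) * gw a x)"
    unfolding eq using i by auto
qed

end

section \<open>Uniform bounds and removal of the regularization\<close>

lemma matrix_vector_mult_norm_bound: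
  fixes A :: "real^'k^'l"
  obtains K where "K \<ge> 0" "\<And>x. norm (A *v x) \<le> K * norm x"
  using bounded_linear.nonneg_bounded[OF matrix_vector_mul_bounded_linear[of A]] by (metis mult.commute)

context shrinkage
begin

lemma norm_v_bound:
  obtains K where "K \<ge> 0" "\<And>x. (norm (v x))\<^sup>2 \<le> K * ell x"
proof -
  obtain c where c: "c > 0" "\<And>x. c * (norm x)\<^sup>2 \<le> x \<bullet> (U *v x)" using pos_def_lower_bound[OF U] by blast
  show ?thesis
    using that[of "1 / c"] c(1) c(2)[of "v _"] by (simp add: field_simps ell_def)
qed

text \<open>The factor \<open>v\<close> in \<open>s\<close> is traded for the square root of
  \<open>ell\<close>, which is what the denominator of r s / ell needs.\<close>

lemma s_bound:
  obtains K where "K \<ge> 0" "\<And>x. (s B x)\<^sup>2 \<le> K * ell x * (norm x)\<^sup>2"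
proof -
  obtain K1 where K1: "K1 \<ge> 0" "\<And>x. norm (B *v x) \<le> K1 * norm x" using matrix_vector_mult_norm_bound[of B] by blast
  obtain K2 where K2: "K2 \<ge> 0" "\<And>x. norm (P *v x) \<le> K2 * norm x" using matrix_vector_mult_norm_bound[of P] by blast
  obtain K3 where K3: "K3 \<ge> 0" "\<And>x. (norm (v x))\<^sup>2 \<le> K3 * ell x" using norm_v_bound by blast
  show ?thesis
  proof (rule that[of "K1\<^sup>2 * K2\<^sup>2 * K3"])
    show "0 \<le> K1\<^sup>2 * K2\<^sup>2 * K3" using K3 by simp
    fix x
    have "\<bar>s B x\<bar> \<le> norm (B *v v x) * norm (P *v x)" unfolding s_def by (rule Cauchy_Schwarz_ineq2)
    also have "\<dots> \<le> (K1 * norm (v x)) * (K2 * norm x)" using K1 K2 by (intro mult_mono) auto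
    finally have "\<bar>s B x\<bar>\<^sup>2 \<le> ((K1 * norm (v x)) * (K2 * norm x))\<^sup>2" by (intro power_mono) auto
    also have "\<dots> = K1\<^sup>2 * K2\<^sup>2 * (norm x)\<^sup>2 * (norm (v x))\<^sup>2" by (simp add: power_mult_distrib mult_ac)
    also have "\<dots> \<le> K1\<^sup>2 * K2\<^sup>2 * (norm x)\<^sup>2 * (K3 * ell x)" using K3 by (intro mult_left_mono) auto
    finally show "(s B x)\<^sup>2 \<le> K1\<^sup>2 * K2\<^sup>2 * K3 * ell x * (norm x)\<^sup>2" by (simp add: mult_ac)
  qed
qed

lemma bil_bound:
  obtains K where "K \<ge> 0" "\<And>x. \<bar>bil B x\<bar> \<le> K * ell x"
proof -
  obtain K1 where K1: "K1 \<ge> 0" "\<And>x. norm (U *v x) \<le> K1 * norm x" using matrix_vector_mult_norm_bound[of U] by blast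
  obtain K2 where K2: "K2 \<ge> 0" "\<And>x. norm ((L ** B) *v x) \<le> K2 * norm x" using matrix_vector_mult_norm_bound[of "L ** B"] by blast
  obtain K3 where K3: "K3 \<ge> 0" "\<And>x. (norm (v x))\<^sup>2 \<le> K3 * ell x" using norm_v_bound by blast
  show ?thesis
  proof (rule that[of "K1 * K2 * K3"])
    show "0 \<le> K1 * K2 * K3" using K1 K2 K3 by simp
    fix x
    have "\<bar>bil B x\<bar> \<le> norm (U *v v x) * norm ((L ** B) *v v x)"
      unfolding bil_def matrix_vector_mul_assoc by (rule Cauchy_Schwarz_ineq2)
    also have "\<dots> \<le> (K1 * norm (v x)) * (K2 * norm (v x))" using K1 K2 by (intro mult_mono) auto
    also have "\<dots> = K1 * K2 * (norm (v x))\<^sup>2" by (simp add: power2_eq_square mult_ac)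
    also have "\<dots> \<le> K1 * K2 * (K3 * ell x)" using K1 K2 K3 by (intro mult_left_mono) auto
    finally show "\<bar>bil B x\<bar> \<le> K1 * K2 * K3 * ell x" by (simp add: mult_ac)
  qed
qed

lemma measurable_facts [measurable]:
  "r \<in> borel_measurable borel" "ell \<in> borel_measurable borel" "s B \<in> borel_measurable borel"
  "bil B \<in> borel_measurable borel" "gw a \<in> borel_measurable borel"
proof -
  have "poly_bounded f \<Longrightarrow> f \<in> borel_measurable borel" for f :: "real^'n \<Rightarrow> real"
    unfolding poly_bounded_def by (auto intro: borel_measurable_continuous_onI)
  then show "r \<in> borel_measurable borel" "ell \<in> borel_measurable borel" "s B \<in> borel_measurable borel"
    "bil B \<in> borel_measurable borel"
    using pb_r pb_ell pb_s pb_bil by auto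
  show "gw a \<in> borel_measurable borel"
    using continuous_gaussian[OF poly_bounded_const[of 1]] by (auto intro: borel_measurable_continuous_onI)
qed

lemma gw_pos: "gw a x > 0"
  by (simp add: gw_def)

lemma pb_norm_sq: "poly_bounded (\<lambda>x::real^'n. (norm x)\<^sup>2)"
proof -
  have "poly_bounded (\<lambda>x::real^'n. x \<bullet> x)"
    using poly_bounded_mult_nth[of "mat 1 :: real^'n^'n"] by (intro poly_bounded_inner) auto
  then show ?thesis by (simp add: power2_norm_eq_inner)
qed

lemma integrable_norm_sq: "a > 0 \<Longrightarrow> integrable lborel (\<lambda>x. (norm x)\<^sup>2 * gw a x)"
  by (rule gaussian_integrable[OF pb_norm_sq])

text \<open>With \<open>B = B0\<close> the divergence dominates \<open>(q - 2) / (ell + \<eta>)\<close>, so that the Stein identity bounds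
  the inverse moment by itself; the bound is uniform in \<open>\<eta>\<close>.\<close>

lemma inverse_moment_regularized:
  obtains K where "K \<ge> 0" "\<And>a \<eta>. a > 0 \<Longrightarrow> \<eta> > 0 \<Longrightarrow>
    (\<integral>x. (r x)\<^sup>2 * inverse (ell x + \<eta>) * gw a x \<partial>lborel) \<le> K * (\<integral>x. (norm x)\<^sup>2 * gw a x \<partial>lborel)"
proof -
  obtain K where K: "K \<ge> 0" "\<And>x. (s B0 x)\<^sup>2 \<le> K * ell x * (norm x)\<^sup>2" using s_bound by blast
  define q where "q = real CARD('q)"
  have q: "q - 2 > 0" using q3 by (simp add: q_def)
  have aux: "I \<le> A / p\<^sup>2 * M" if "p > 0" "0 \<le> A / (2 * p) * M - p / 2 * I" for A I M p :: real
    using that by (simp add: field_simps power2_eq_square)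
  show ?thesis
  proof (rule that[of "(m + 2)\<^sup>2 * K / (q - 2)\<^sup>2"])
    show "0 \<le> (m + 2)\<^sup>2 * K / (q - 2)\<^sup>2" using K by simp
    fix a \<eta> :: real assume a: "a > 0" and \<eta>: "\<eta> > 0"
    let ?g = "\<lambda>x. inverse (ell x + \<eta>)"
    define C where "C = (m + 2)\<^sup>2 * K / (2 * (q - 2))"
    have pw: "((m + 2) * (r x * s B0 x * ?g x) - (r x)\<^sup>2 * D \<eta> B0 x) * gw a x
        \<le> C * ((norm x)\<^sup>2 * gw a x) - (q - 2) / 2 * ((r x)\<^sup>2 * ?g x * gw a x)" for x
    proof -
      have g: "?g x \<ge> 0" "ell x * ?g x \<le> 1" using ell_nonneg[of x] \<eta> by (auto simp: field_simps)
      have D: "(q - 2) * ?g x \<le> D \<eta> B0 x"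
      proof -
        have "ell x * ?g x * ?g x \<le> 1 * ?g x" using g by (intro mult_right_mono) auto
        moreover have "bil B0 x = ell x" by (simp add: bil_def ell_def matrix_vector_mul_assoc LB0 inner_commute)
        moreover have "trace (L ** B0) = q" by (simp add: LB0 trace_def mat_def q_def)
        ultimately show ?thesis by (simp add: D_def power2_eq_square algebra_simps)
      qed
      \<comment> \<open>Young's inequality with weights such that the r^2 term takes half of the
        coefficient q - 2 supplied by the divergence. The other half survives as the bound on the
        inverse moment.\<close>
      have "0 \<le> ((q - 2) * r x - (m + 2) * s B0 x)\<^sup>2 / (2 * (q - 2))" using q by simp
      also have "\<dots> = (q - 2) / 2 * (r x)\<^sup>2 + (m + 2)\<^sup>2 / (2 * (q - 2)) * (s B0 x)\<^sup>2 - (m + 2) * (r x * s B0 x)"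
        using q by (simp add: power2_eq_square field_simps)
      finally have "(m + 2) * (r x * s B0 x) \<le> (q - 2) / 2 * (r x)\<^sup>2 + (m + 2)\<^sup>2 / (2 * (q - 2)) * (s B0 x)\<^sup>2" by simp
      also have "\<dots> \<le> (q - 2) / 2 * (r x)\<^sup>2 + (m + 2)\<^sup>2 / (2 * (q - 2)) * (K * ell x * (norm x)\<^sup>2)"
        using K q by (intro add_left_mono mult_left_mono) auto
      finally have "(m + 2) * (r x * s B0 x) * ?g x
          \<le> ((q - 2) / 2 * (r x)\<^sup>2 + C * (norm x)\<^sup>2 * ell x) * ?g x"
        using g by (intro mult_right_mono) (auto simp: C_def mult_ac)
      also have "\<dots> = (q - 2) / 2 * (r x)\<^sup>2 * ?g x + C * (norm x)\<^sup>2 * (ell x * ?g x)" by (simp add: algebra_simps)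
      also have "\<dots> \<le> (q - 2) / 2 * (r x)\<^sup>2 * ?g x + C * (norm x)\<^sup>2 * 1"
        using g K q by (intro add_left_mono mult_left_mono) (auto simp: C_def)
      finally have 1: "(m + 2) * (r x * s B0 x) * ?g x \<le> (q - 2) / 2 * (r x)\<^sup>2 * ?g x + C * (norm x)\<^sup>2" by simp
      have 2: "(r x)\<^sup>2 * ((q - 2) * ?g x) \<le> (r x)\<^sup>2 * D \<eta> B0 x" using D by (intro mult_left_mono) auto
      have "(m + 2) * (r x * s B0 x * ?g x) - (r x)\<^sup>2 * D \<eta> B0 x
          \<le> C * (norm x)\<^sup>2 - (q - 2) / 2 * ((r x)\<^sup>2 * ?g x)"
        using 1 2 by (simp add: algebra_simps diff_divide_distrib)
      then have "((m + 2) * (r x * s B0 x * ?g x) - (r x)\<^sup>2 * D \<eta> B0 x) * gw a x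
          \<le> (C * (norm x)\<^sup>2 - (q - 2) / 2 * ((r x)\<^sup>2 * ?g x)) * gw a x"
        using gw_pos[of a x] by (intro mult_right_mono) auto
      then show ?thesis by (simp add: algebra_simps)
    qed
    have i: "integrable lborel (\<lambda>x. (r x)\<^sup>2 * ?g x * gw a x)"
      by (intro gaussian_integrable poly_bounded_mult poly_bounded_power pb_r pb_inv a \<eta>)
    have "0 \<le> (\<integral>x. C * ((norm x)\<^sup>2 * gw a x) - (q - 2) / 2 * ((r x)\<^sup>2 * ?g x * gw a x) \<partial>lborel)"
      unfolding stein_regularized(1)[OF NB0 \<eta> a, symmetric]
      by (intro integral_mono pw stein_regularized(2)[OF NB0 \<eta> a] Bochner_Integration.integrable_diff
          integrable_mult_right i integrable_norm_sq a)
    also have "\<dots> = C * (\<integral>x. (norm x)\<^sup>2 * gw a x \<partial>lborel) - (q - 2) / 2 * (\<integral>x. (r x)\<^sup>2 * ?g x * gw a x \<partial>lborel)"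
      using i integrable_norm_sq[OF a] by (subst Bochner_Integration.integral_diff) auto
    finally show "(\<integral>x. (r x)\<^sup>2 * ?g x * gw a x \<partial>lborel)
        \<le> (m + 2)\<^sup>2 * K / (q - 2)\<^sup>2 * (\<integral>x. (norm x)\<^sup>2 * gw a x \<partial>lborel)"
      unfolding C_def using aux[OF q] by blast
  qed
qed

text \<open>Fatou's lemma along \<eta> = 1 / (k + 1): the bound of the regularized moments does not
  depend on \<eta>, so it passes to the limit and yields integrability as well.\<close>

lemma inverse_moment:
  obtains K where "K \<ge> 0" "\<And>a. a > 0 \<Longrightarrow> integrable lborel (\<lambda>x. (r x)\<^sup>2 / ell x * gw a x)"
    "\<And>a. a > 0 \<Longrightarrow> (\<integral>x. (r x)\<^sup>2 / ell x * gw a x \<partial>lborel) \<le> K * (\<integral>x. (norm x)\<^sup>2 * gw a x \<partial>lborel)"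
proof -
  obtain K where K: "K \<ge> 0" and bound: "\<And>a \<eta>. a > 0 \<Longrightarrow> \<eta> > 0 \<Longrightarrow>
    (\<integral>x. (r x)\<^sup>2 * inverse (ell x + \<eta>) * gw a x \<partial>lborel) \<le> K * (\<integral>x. (norm x)\<^sup>2 * gw a x \<partial>lborel)"
    using inverse_moment_regularized by blast
  have nn: "(\<integral>\<^sup>+x. ennreal ((r x)\<^sup>2 / ell x * gw a x) \<partial>lborel) \<le> ennreal (K * (\<integral>x. (norm x)\<^sup>2 * gw a x \<partial>lborel))"
    if a: "a > 0" for a
  proof -
    let ?u = "\<lambda>k x. (r x)\<^sup>2 * inverse (ell x + inverse (real (Suc k))) * gw a x"
    have u_nonneg: "?u k x \<ge> 0" for k x
      using ell_nonneg[of x] gw_pos[of a x] by (intro mult_nonneg_nonneg) auto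
    have "(\<integral>\<^sup>+x. ennreal ((r x)\<^sup>2 / ell x * gw a x) \<partial>lborel) \<le> (\<integral>\<^sup>+x. liminf (\<lambda>k. ennreal (?u k x)) \<partial>lborel)"
    proof (rule nn_integral_mono)
      fix x
      show "ennreal ((r x)\<^sup>2 / ell x * gw a x) \<le> liminf (\<lambda>k. ennreal (?u k x))"
      \<comment> \<open>Where \<open>ell x = 0\<close> the left side is 0 by the convention for
        division by zero, so the inequality holds at every point.\<close>
      proof (cases "ell x = 0")
        case False
        have "(\<lambda>k. ?u k x) \<longlonglongrightarrow> (r x)\<^sup>2 * inverse (ell x + 0) * gw a x"
          using False by (intro tendsto_intros LIMSEQ_inverse_real_of_nat) auto
        then have "(\<lambda>k. ennreal (?u k x)) \<longlonglongrightarrow> ennreal ((r x)\<^sup>2 / ell x * gw a x)"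
          by (intro tendsto_ennrealI) (simp add: divide_inverse)
        then show ?thesis by (simp add: lim_imp_Liminf)
      qed simp
    qed
    also have "\<dots> \<le> liminf (\<lambda>k. \<integral>\<^sup>+x. ennreal (?u k x) \<partial>lborel)"
      by (rule nn_integral_liminf) measurable
    also have "\<dots> \<le> ennreal (K * (\<integral>x. (norm x)\<^sup>2 * gw a x \<partial>lborel))"
    proof (rule Liminf_le)
      show "\<forall>\<^sub>F k in sequentially. (\<integral>\<^sup>+x. ennreal (?u k x) \<partial>lborel) \<le> ennreal (K * (\<integral>x. (norm x)\<^sup>2 * gw a x \<partial>lborel))"
      proof (rule always_eventually, rule allI)
        fix k
        have i: "integrable lborel (?u k)"
          by (intro gaussian_integrable poly_bounded_mult poly_bounded_power pb_r pb_inv a) simp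
        show "(\<integral>\<^sup>+x. ennreal (?u k x) \<partial>lborel) \<le> ennreal (K * (\<integral>x. (norm x)\<^sup>2 * gw a x \<partial>lborel))"
          unfolding nn_integral_eq_integral[OF i AE_I2[OF u_nonneg]]
          by (intro ennreal_leI bound a) simp
      qed
    qed simp
    finally show ?thesis .
  qed
  have nonneg: "(r x)\<^sup>2 / ell x * gw a x \<ge> 0" for a x
    using ell_nonneg[of x] gw_pos[of a x] by simp
  have int: "integrable lborel (\<lambda>x. (r x)\<^sup>2 / ell x * gw a x)" if "a > 0" for a
    using nn[OF that] nonneg by (intro integrableI_nonneg) (auto simp: le_less_trans)
  show ?thesis
  proof (rule that[OF K int])
    fix a :: real assume a: "a > 0"
    have "0 \<le> K * (\<integral>x. (norm x)\<^sup>2 * gw a x \<partial>lborel)"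
      using K gw_pos[of a] by (intro mult_nonneg_nonneg integral_nonneg_AE) (auto simp: less_imp_le)
    then show "(\<integral>x. (r x)\<^sup>2 / ell x * gw a x \<partial>lborel) \<le> K * (\<integral>x. (norm x)\<^sup>2 * gw a x \<partial>lborel)"
      using nn[OF a] nn_integral_eq_integral[OF int[OF a] AE_I2[OF nonneg]] by (simp add: ennreal_le_iff)
  qed
qed

text \<open>Bounding |r s| by r^2 + s^2 leaves a factor \<open>ell\<close> in the second term, by
  \<open>s_bound\<close>, to cancel the denominator. One majorant covers the limit and all
  regularizations, as dominated convergence requires.\<close>

lemma cross_bound:
  obtains K where "K \<ge> 0" "\<And>x. \<bar>r x * s B x / ell x\<bar> \<le> K * (norm x)\<^sup>2 + (r x)\<^sup>2 / ell x"
    "\<And>x \<eta>. \<eta> > 0 \<Longrightarrow> ell x \<noteq> 0 \<Longrightarrow> \<bar>r x * s B x * inverse (ell x + \<eta>)\<bar> \<le> K * (norm x)\<^sup>2 + (r x)\<^sup>2 / ell x"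
proof -
  obtain K where K: "K \<ge> 0" "\<And>x. (s B x)\<^sup>2 \<le> K * ell x * (norm x)\<^sup>2" using s_bound by blast
  have 0: "\<bar>r x * s B x / ell x\<bar> \<le> K * (norm x)\<^sup>2 + (r x)\<^sup>2 / ell x" for x
  proof (cases "ell x = 0")
    case False
    then have pos: "ell x > 0" using ell_nonneg[of x] by simp
    have "\<bar>r x * s B x\<bar> \<le> (s B x)\<^sup>2 + (r x)\<^sup>2"
      using sum_squares_bound[of "\<bar>r x\<bar>" "\<bar>s B x\<bar>"] mult_nonneg_nonneg[of "\<bar>r x\<bar>" "\<bar>s B x\<bar>"]
      unfolding abs_mult power2_abs by linarith
    also have "\<dots> \<le> K * ell x * (norm x)\<^sup>2 + (r x)\<^sup>2" using K by simp
    finally show ?thesis using pos by (simp add: field_simps)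
  qed (use K in simp)
  show ?thesis
  proof (rule that[OF K(1) 0])
    fix x and \<eta> :: real assume "\<eta> > 0" "ell x \<noteq> 0"
    then have "inverse (ell x + \<eta>) \<le> inverse (ell x)" "0 \<le> inverse (ell x + \<eta>)"
      using ell_nonneg[of x] by (auto intro!: le_imp_inverse_le)
    then have "\<bar>r x * s B x\<bar> * \<bar>inverse (ell x + \<eta>)\<bar> \<le> \<bar>r x * s B x\<bar> * \<bar>inverse (ell x)\<bar>"
      using ell_nonneg[of x] by (intro mult_left_mono) auto
    then show "\<bar>r x * s B x * inverse (ell x + \<eta>)\<bar> \<le> K * (norm x)\<^sup>2 + (r x)\<^sup>2 / ell x"
      using 0[of x] ell_nonneg[of x] by (simp add: abs_mult divide_inverse mult.assoc)
  qed
qed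

text \<open>The case \<eta> = 0 of the integrand in \<open>stein_regularized\<close>.\<close>

definition "\<Phi> B x = (m + 2) * (r x * s B x / ell x)
  - (r x)\<^sup>2 * (trace (L ** B) / ell x - 2 * bil B x / (ell x)\<^sup>2)"

lemma measurable_\<Phi> [measurable]: "\<Phi> B \<in> borel_measurable borel"
  unfolding \<Phi>_def by measurable

lemma \<Phi>_bound:
  obtains K where "K \<ge> 0" "\<And>x. \<bar>\<Phi> B x\<bar> \<le> K * ((norm x)\<^sup>2 + (r x)\<^sup>2 / ell x)"
    "\<And>x \<eta>. \<eta> > 0 \<Longrightarrow> ell x \<noteq> 0 \<Longrightarrow>
      \<bar>(m + 2) * (r x * s B x * inverse (ell x + \<eta>)) - (r x)\<^sup>2 * D \<eta> B x\<bar> \<le> K * ((norm x)\<^sup>2 + (r x)\<^sup>2 / ell x)"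
proof -
  obtain K1 where K1: "K1 \<ge> 0" "\<And>x. \<bar>r x * s B x / ell x\<bar> \<le> K1 * (norm x)\<^sup>2 + (r x)\<^sup>2 / ell x"
    "\<And>x \<eta>. \<eta> > 0 \<Longrightarrow> ell x \<noteq> 0 \<Longrightarrow> \<bar>r x * s B x * inverse (ell x + \<eta>)\<bar> \<le> K1 * (norm x)\<^sup>2 + (r x)\<^sup>2 / ell x"
    using cross_bound[where B=B] by metis
  obtain K2 where K2: "K2 \<ge> 0" "\<And>x. \<bar>bil B x\<bar> \<le> K2 * ell x" using bil_bound by blast
  let ?T = "\<bar>trace (L ** B)\<bar>"
  define K where "K = \<bar>m + 2\<bar> * (K1 + 1) + ?T + 2 * K2"
  \<comment> \<open>Here \<open>g\<close> stands for both 1 / ell and 1 / (ell + \<eta>); the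
    estimate uses only that it lies between 0 and 1 / ell.\<close>
  have comb: "\<bar>(m + 2) * c - (r x)\<^sup>2 * (trace (L ** B) * g - 2 * bil B x * g\<^sup>2)\<bar> \<le> K * ((norm x)\<^sup>2 + (r x)\<^sup>2 / ell x)"
    if c: "\<bar>c\<bar> \<le> K1 * (norm x)\<^sup>2 + (r x)\<^sup>2 / ell x" and g: "0 \<le> g" "g \<le> inverse (ell x)" for c g x
  proof -
    let ?e = "(r x)\<^sup>2 / ell x"
    have e: "0 \<le> ?e" using ell_nonneg[of x] by simp
    have g': "(r x)\<^sup>2 * g \<le> ?e" using mult_left_mono[OF g(2), of "(r x)\<^sup>2"] by (simp add: divide_inverse)
    have lg: "ell x * g \<le> 1"
      using mult_left_mono[OF g(2) ell_nonneg[of x]] by (cases "ell x = 0") auto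
    have "\<bar>bil B x * g\<bar> \<le> K2 * (ell x * g)"
      using mult_right_mono[OF K2(2)[of x] g(1)] g(1) by (simp add: abs_mult mult.assoc)
    also have "\<dots> \<le> K2 * 1" using lg K2 by (intro mult_left_mono) auto
    finally have bg: "\<bar>bil B x * g\<bar> \<le> K2" by simp
    have "\<bar>trace (L ** B) - 2 * (bil B x * g)\<bar> \<le> ?T + 2 * K2" using bg by linarith
    then have "((r x)\<^sup>2 * g) * \<bar>trace (L ** B) - 2 * (bil B x * g)\<bar> \<le> ?e * (?T + 2 * K2)"
      using g' e g(1) K2(1) by (intro mult_mono) auto
    moreover have "\<bar>(r x)\<^sup>2 * (trace (L ** B) * g - 2 * bil B x * g\<^sup>2)\<bar> = ((r x)\<^sup>2 * g) * \<bar>trace (L ** B) - 2 * (bil B x * g)\<bar>"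
    proof -
      have "(r x)\<^sup>2 * (trace (L ** B) * g - 2 * bil B x * g\<^sup>2) = ((r x)\<^sup>2 * g) * (trace (L ** B) - 2 * (bil B x * g))"
        by (simp add: algebra_simps power2_eq_square)
      then show ?thesis using g(1) by (simp only: abs_mult) simp
    qed
    ultimately have 1: "\<bar>(r x)\<^sup>2 * (trace (L ** B) * g - 2 * bil B x * g\<^sup>2)\<bar> \<le> (?T + 2 * K2) * ?e"
      by (simp add: mult_ac)
    have aux: "K1 * n + e \<le> (K1 + 1) * (n + e)" if "0 \<le> e" "0 \<le> n" for n e
      using that K1(1) by (simp add: algebra_simps)
    have "\<bar>(m + 2) * c\<bar> \<le> \<bar>m + 2\<bar> * (K1 * (norm x)\<^sup>2 + ?e)"
      unfolding abs_mult using c by (intro mult_left_mono) auto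
    also have "\<dots> \<le> \<bar>m + 2\<bar> * ((K1 + 1) * ((norm x)\<^sup>2 + ?e))"
      using aux[OF e, of "(norm x)\<^sup>2"] by (intro mult_left_mono) auto
    finally have 2: "\<bar>(m + 2) * c\<bar> \<le> \<bar>m + 2\<bar> * (K1 + 1) * ((norm x)\<^sup>2 + ?e)" by simp
    have "(?T + 2 * K2) * ?e \<le> (?T + 2 * K2) * ((norm x)\<^sup>2 + ?e)"
      using K2(1) by (intro mult_left_mono) auto
    moreover have "K * ((norm x)\<^sup>2 + ?e) = \<bar>m + 2\<bar> * (K1 + 1) * ((norm x)\<^sup>2 + ?e) + (?T + 2 * K2) * ((norm x)\<^sup>2 + ?e)"
      by (simp only: K_def distrib_right add.assoc)
    ultimately show ?thesis using 1 2 by linarith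
  qed
  show ?thesis
  proof (rule that[of K])
    show "K \<ge> 0" using K1 K2 by (simp add: K_def)
    show "\<bar>\<Phi> B x\<bar> \<le> K * ((norm x)\<^sup>2 + (r x)\<^sup>2 / ell x)" for x
      using comb[OF K1(2)[of x], of "inverse (ell x)"] ell_nonneg[of x]
      by (simp add: \<Phi>_def divide_inverse power_inverse)
    show "\<bar>(m + 2) * (r x * s B x * inverse (ell x + \<eta>)) - (r x)\<^sup>2 * D \<eta> B x\<bar> \<le> K * ((norm x)\<^sup>2 + (r x)\<^sup>2 / ell x)"
      if "\<eta> > 0" "ell x \<noteq> 0" for x \<eta>
      unfolding D_def using that ell_nonneg[of x] by (intro comb K1(3)) (auto intro!: le_imp_inverse_le)
  qed
qed

lemma AE_ell_nonzero: "AE x in lborel. ell x \<noteq> 0"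
proof -
  have "L \<noteq> 0"
  proof
    assume "L = 0"
    then have "(mat 1 :: real^'q^'q) = 0" using LB0 by simp
    then have "(mat 1 :: real^'q^'q) $ undefined $ undefined = 0" by simp
    then show False by (simp add: mat_def)
  qed
  from AE_not_affine_preimage[OF this, of "- v0"] show ?thesis
    by eventually_elim (simp add: ell_eq_0 v_def add_eq_0_iff)
qed

text \<open>Dominated convergence as \<eta> tends to 0, with the inverse moment supplying the
  majorant. The exceptional set where \<open>ell\<close> vanishes is null.\<close>

lemma stein:
  assumes NB: "N ** B = 0" and a: "a > 0"
  shows "(\<integral>x. \<Phi> B x * gw a x \<partial>lborel) = 0"
proof -
  obtain K where K: "K \<ge> 0" "\<And>x \<eta>. \<eta> > 0 \<Longrightarrow> ell x \<noteq> 0 \<Longrightarrow>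
      \<bar>(m + 2) * (r x * s B x * inverse (ell x + \<eta>)) - (r x)\<^sup>2 * D \<eta> B x\<bar> \<le> K * ((norm x)\<^sup>2 + (r x)\<^sup>2 / ell x)"
    using \<Phi>_bound[where B=B] by metis
  have i: "integrable lborel (\<lambda>x. (r x)\<^sup>2 / ell x * gw a x)" using inverse_moment a by metis
  let ?h = "\<lambda>k. inverse (real (Suc k))"
  let ?f = "\<lambda>k x. ((m + 2) * (r x * s B x * inverse (ell x + ?h k)) - (r x)\<^sup>2 * D (?h k) B x) * gw a x"
  have "(\<lambda>k. \<integral>x. ?f k x \<partial>lborel) \<longlonglongrightarrow> (\<integral>x. \<Phi> B x * gw a x \<partial>lborel)"
  proof (rule integral_dominated_convergence)
    show "integrable lborel (\<lambda>x. K * ((norm x)\<^sup>2 * gw a x + (r x)\<^sup>2 / ell x * gw a x))"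
      using i integrable_norm_sq[OF a] by auto
    show "AE x in lborel. (\<lambda>k. ?f k x) \<longlonglongrightarrow> \<Phi> B x * gw a x"
      using AE_ell_nonzero
    proof eventually_elim
      fix x assume nz: "ell x \<noteq> 0"
      have "(\<lambda>k. ?f k x) \<longlonglongrightarrow> ((m + 2) * (r x * s B x * inverse (ell x + 0))
          - (r x)\<^sup>2 * (trace (L ** B) * inverse (ell x + 0) - 2 * bil B x * (inverse (ell x + 0))\<^sup>2)) * gw a x"
        unfolding D_def using nz by (intro tendsto_intros LIMSEQ_inverse_real_of_nat) auto
      then show "(\<lambda>k. ?f k x) \<longlonglongrightarrow> \<Phi> B x * gw a x"
        by (simp add: \<Phi>_def divide_inverse power_inverse)
    qed
    show "AE x in lborel. norm (?f k x) \<le> K * ((norm x)\<^sup>2 * gw a x + (r x)\<^sup>2 / ell x * gw a x)" for k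
      using AE_ell_nonzero
    proof eventually_elim
      fix x assume nz: "ell x \<noteq> 0"
      show "norm (?f k x) \<le> K * ((norm x)\<^sup>2 * gw a x + (r x)\<^sup>2 / ell x * gw a x)"
        using mult_right_mono[OF K(2)[OF _ nz, of "?h k"], of "gw a x"] gw_pos[of a x]
        unfolding real_norm_def abs_mult[of _ "gw a x"] abs_of_pos[OF gw_pos]
        by (simp only: mult.assoc distrib_right) simp
    qed
  qed (unfold D_def, measurable)
  then show ?thesis
    by (simp add: stein_regularized(1)[OF NB _ a] LIMSEQ_const_iff del: of_nat_Suc)
qed

end

section \<open>Signed normal mixtures\<close>

lemma matrix_inv_right_left:
  fixes A :: "real^'n^'n"
  assumes "invertible A"
  shows "A ** matrix_inv A = mat 1" "matrix_inv A ** A = mat 1"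
  using assms unfolding invertible_def matrix_inv_def
  by (metis (mono_tags, lifting) someI_ex)+

lemma matrix_inv_eqI:
  fixes A B :: "real^'n^'n"
  assumes "A ** B = mat 1"
  shows "matrix_inv A = B"
proof -
  have "invertible A" using assms by (metis invertible_def matrix_left_right_inverse)
  then show ?thesis
    using matrix_inv_right_left(2) assms by (metis matrix_mul_assoc matrix_mul_lid matrix_mul_rid)
qed

lemma pos_def_invertible:
  fixes A :: "real^'n^'n"
  assumes "pos_def A"
  shows "invertible A"
proof -
  have "x = 0" if "A *v x = 0" for x using assms that unfolding pos_def_def by (metis inner_zero_right less_irrefl)
  then obtain B where "B ** A = mat 1" using matrix_left_invertible_ker by metis
  then show ?thesis by (metis invertible_def matrix_left_right_inverse)
qed

lemma pos_def_matrix_inv: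
  fixes A :: "real^'n^'n"
  assumes "pos_def A"
  shows "pos_def (matrix_inv A)"
proof -
  note inv = matrix_inv_right_left[OF pos_def_invertible[OF assms]]
  have sym: "transpose A = A" using assms by (simp add: pos_def_def)
  have "A ** transpose (matrix_inv A) = mat 1"
    using arg_cong[OF inv(2), of transpose] by (simp add: matrix_transpose_mul sym transpose_mat)
  then have "transpose (matrix_inv A) = matrix_inv A" using matrix_inv_eqI by metis
  moreover have "x \<bullet> (matrix_inv A *v x) > 0" if "x \<noteq> 0" for x
  proof -
    define y where "y = matrix_inv A *v x"
    have x: "x = A *v y" by (simp add: y_def matrix_vector_mul_assoc inv)
    then have "y \<noteq> 0" using that by auto
    then have "y \<bullet> (A *v y) > 0" using assms by (simp add: pos_def_def)
    then show ?thesis unfolding y_def[symmetric] using x by (simp add: inner_commute)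
  qed
  ultimately show ?thesis by (simp add: pos_def_def)
qed

text \<open>Up to a constant free of a, the density of the centred normal law with precision matrix
  2 a P. The power of a keeps the total mass constant in a, so that integrals can be compared across
  mixture components.\<close>

definition gauss_kernel :: "real^'n^'n \<Rightarrow> real \<Rightarrow> real^'n \<Rightarrow> real" where
  "gauss_kernel P a x = a powr (real CARD('n) / 2) * exp (- a * (x \<bullet> (P *v x)))"

lemma borel_measurable_quad_form [measurable]:
  fixes P :: "real^'n^'n"
  shows "(\<lambda>x. x \<bullet> (P *v x)) \<in> borel_measurable borel"
  by (intro borel_measurable_continuous_onI continuous_intros matrix_vector_mult_linear_continuous_on)

lemma borel_measurable_gauss_kernel [measurable]: "gauss_kernel P a \<in> borel_measurable borel"
  unfolding gauss_kernel_def by measurable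

lemma gauss_kernel_scaling:
  fixes P :: "real^'n^'n" and f :: "real^'n \<Rightarrow> real"
  assumes f [measurable]: "f \<in> borel_measurable borel" and a: "a > 0"
  shows "(\<integral>x. f x * gauss_kernel P a x \<partial>lborel) = (\<integral>x. f (a powr (-1/2) *\<^sub>R x) * gauss_kernel P 1 x \<partial>lborel)"
proof -
  define c where "c = a powr (-1/2)"
  have c: "c > 0" using a by (simp add: c_def)
  have c2: "a * c\<^sup>2 = 1"
    using a by (simp add: c_def powr_power powr_minus divide_simps)
  have cn: "c ^ CARD('n) * a powr (real CARD('n) / 2) = 1"
    using a by (simp add: c_def powr_power flip: powr_add)
  have "(\<integral>x. f x * gauss_kernel P a x \<partial>lborel)
      = (\<integral>x. f x * gauss_kernel P a x \<partial>density (distr lborel borel (\<lambda>x. 0 + c *\<^sub>R x)) (\<lambda>_. ennreal (\<bar>c\<bar> ^ DIM(real^'n))))"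
    using lborel_affine[of c "0::real^'n"] c by (simp add: ennreal_power)
  also have "\<dots> = (\<integral>x. c ^ CARD('n) * (f (c *\<^sub>R x) * gauss_kernel P a (c *\<^sub>R x)) \<partial>lborel)"
    using c by (subst integral_density) (auto simp: integral_distr)
  also have "\<dots> = (\<integral>x. f (c *\<^sub>R x) * gauss_kernel P 1 x \<partial>lborel)"
  proof (rule Bochner_Integration.integral_cong[OF refl])
    fix x :: "real^'n"
    have "a * ((c *\<^sub>R x) \<bullet> (P *v (c *\<^sub>R x))) = (a * c\<^sup>2) * (x \<bullet> (P *v x))"
      by (simp add: matrix_vector_mult_scaleR power2_eq_square)
    then have "c ^ CARD('n) * (f (c *\<^sub>R x) * gauss_kernel P a (c *\<^sub>R x))
        = (c ^ CARD('n) * a powr (real CARD('n) / 2)) * (f (c *\<^sub>R x) * exp (- (a * c\<^sup>2) * (x \<bullet> (P *v x))))"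
      by (simp add: gauss_kernel_def)
    then show "c ^ CARD('n) * (f (c *\<^sub>R x) * gauss_kernel P a (c *\<^sub>R x)) = f (c *\<^sub>R x) * gauss_kernel P 1 x"
      by (simp add: cn c2 gauss_kernel_def)
  qed
  finally show ?thesis by (simp add: c_def)
qed

lemma scaleR_matrix_mult: "(a *\<^sub>R A) ** (b *\<^sub>R B) = (a * b) *\<^sub>R (A ** B)" for A :: "real^'k^'l"
  by (simp add: vec_eq_iff matrix_matrix_mult_def sum_distrib_left mult_ac)

lemma mvn_density_eq_gauss_kernel:
  fixes V :: "real^'n^'n"
  assumes V: "pos_def V" and \<sigma>: "\<sigma> > 0"
  obtains \<kappa> where "\<kappa> > 0"
    "\<And>t x. t > 0 \<Longrightarrow> mvn_density 0 ((\<sigma>\<^sup>2 / t) *\<^sub>R V) x = \<kappa> * gauss_kernel (matrix_inv V) (t / (2 * \<sigma>\<^sup>2)) x"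
proof -
  \<comment> \<open>The power of 2 from the normal density and the scale \<sigma>^2 / t are both
    absorbed by the kernel parameter t / (2 \<sigma>^2), so \<kappa> does not depend on t.\<close>
  define \<kappa> where "\<kappa> = pi powr (- real CARD('n) / 2) * det V powr (-1/2)"
  have inv: "invertible V" by (rule pos_def_invertible[OF V])
  have "mvn_density 0 ((\<sigma>\<^sup>2 / t) *\<^sub>R V) x = \<kappa> * gauss_kernel (matrix_inv V) (t / (2 * \<sigma>\<^sup>2)) x" if t: "t > 0" for t x
  proof -
    let ?n = "real CARD('n)"
    have s: "\<sigma>\<^sup>2 / t > 0" using \<sigma> t by simp
    have scale: "c *\<^sub>R V = mat c ** V" for c
      by (simp add: vec_eq_iff matrix_matrix_mult_def mat_def if_distrib[of "\<lambda>z. z * _"] cong: if_cong)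
    have "((\<sigma>\<^sup>2 / t) *\<^sub>R V) ** ((t / \<sigma>\<^sup>2) *\<^sub>R matrix_inv V) = mat 1"
      using \<sigma> t matrix_inv_right_left(1)[OF inv] by (simp add: scaleR_matrix_mult)
    then have mi: "matrix_inv ((\<sigma>\<^sup>2 / t) *\<^sub>R V) = (t / \<sigma>\<^sup>2) *\<^sub>R matrix_inv V" by (rule matrix_inv_eqI)
    have d: "det ((\<sigma>\<^sup>2 / t) *\<^sub>R V) = (\<sigma>\<^sup>2 / t) ^ CARD('n) * det V"
      unfolding scale det_mul by (subst det_diagonal) (auto simp: mat_def)
    have "((\<sigma>\<^sup>2 / t) ^ CARD('n)) powr (-1/2) = (t / \<sigma>\<^sup>2) powr (?n / 2)"
    proof -
      have "((\<sigma>\<^sup>2 / t) ^ CARD('n)) powr (-1/2) = ((\<sigma>\<^sup>2 / t) powr ?n) powr (-1/2)"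
        using s by (simp add: powr_realpow)
      also have "\<dots> = (inverse (t / \<sigma>\<^sup>2)) powr (- (?n / 2))"
        by (simp add: powr_powr)
      also have "\<dots> = (t / \<sigma>\<^sup>2) powr (?n / 2)"
        using \<sigma> t by (subst inverse_powr) (auto simp: powr_minus)
      finally show ?thesis .
    qed
    moreover have "(2 * pi) powr (- ?n / 2) = pi powr (- ?n / 2) * (1 / 2) powr (?n / 2)"
      by (simp add: powr_mult powr_minus powr_divide divide_simps)
    moreover have "(t / (2 * \<sigma>\<^sup>2)) powr (?n / 2) = (1 / 2) powr (?n / 2) * (t / \<sigma>\<^sup>2) powr (?n / 2)"
      by (simp flip: powr_mult)
    moreover have "- (x \<bullet> (((t / \<sigma>\<^sup>2) *\<^sub>R matrix_inv V) *v x)) / 2 = - (t / (2 * \<sigma>\<^sup>2)) * (x \<bullet> (matrix_inv V *v x))"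
      by (simp add: scaleR_matrix_vector_assoc[symmetric])
    ultimately show ?thesis
      unfolding mvn_density_def mi d powr_mult gauss_kernel_def \<kappa>_def by (simp add: mult_ac)
  qed
  moreover have "det V \<noteq> 0" using inv by (simp add: invertible_det_nz)
  then have "\<kappa> > 0" by (simp add: \<kappa>_def)
  ultimately show ?thesis using that by blast
qed

text \<open>Constant mass and a second moment of order 1 / a correspond to the two mixing
  conditions: finite total mass and integrable 1 / t.\<close>

lemma gauss_kernel_moments:
  fixes P :: "real^'n^'n"
  assumes a: "a > 0"
  shows "(\<integral>x. gauss_kernel P a x \<partial>lborel) = (\<integral>x. gauss_kernel P 1 x \<partial>lborel)"
    and "(\<integral>x. (norm x)\<^sup>2 * gauss_kernel P a x \<partial>lborel) = (\<integral>x. (norm x)\<^sup>2 * gauss_kernel P 1 x \<partial>lborel) / a"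
proof -
  show "(\<integral>x. gauss_kernel P a x \<partial>lborel) = (\<integral>x. gauss_kernel P 1 x \<partial>lborel)"
    using gauss_kernel_scaling[of "\<lambda>_. 1" a P] a by simp
  have "(a powr (-1/2))\<^sup>2 = inverse a"
    using a powr_power[of a "-1/2" 2] by (simp add: powr_minus)
  then have "(norm (a powr (-1/2) *\<^sub>R x))\<^sup>2 = inverse a * (norm x)\<^sup>2" for x :: "real^'n"
    by (simp only: norm_scaleR power_mult_distrib power2_abs real_norm_def)
  note nrm = this
  have "(\<integral>x. (norm x)\<^sup>2 * gauss_kernel P a x \<partial>lborel)
      = (\<integral>x. inverse a * ((norm x)\<^sup>2 * gauss_kernel P 1 x) \<partial>lborel)"
    using gauss_kernel_scaling[of "\<lambda>x. (norm x)\<^sup>2" a P, OF _ a] unfolding nrm mult.assoc by simp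
  then show "(\<integral>x. (norm x)\<^sup>2 * gauss_kernel P a x \<partial>lborel) = (\<integral>x. (norm x)\<^sup>2 * gauss_kernel P 1 x \<partial>lborel) / a"
    by (simp add: divide_inverse)
qed

lemma integral_gauss_kernel_pos:
  fixes P :: "real^'n^'n"
  assumes P: "pos_def P"
  shows "(\<integral>x. gauss_kernel P 1 x \<partial>lborel) > 0"
proof -
  have i: "integrable lborel (gauss_kernel P 1)"
    using poly_bounded_integrable_gaussian[OF poly_bounded_const[of 1] P, of 1]
    by (simp add: gauss_kernel_def[abs_def])
  have pos: "gauss_kernel P 1 x > 0" for x by (simp add: gauss_kernel_def)
  have "(\<integral>x. gauss_kernel P 1 x \<partial>lborel) \<noteq> 0"
  proof
    assume "(\<integral>x. gauss_kernel P 1 x \<partial>lborel) = 0"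
    then have "AE x in (lborel :: (real^'n) measure). gauss_kernel P 1 x = 0"
      using integral_nonneg_eq_0_iff_AE[OF i] pos by (auto simp: less_imp_le)
    then have "AE x in (lborel :: (real^'n) measure). False"
      by eventually_elim (use pos in \<open>metis less_irrefl\<close>)
    then show False by (auto simp: trivial_limit_def[symmetric] ae_filter_eq_bot_iff)
  qed
  moreover have "(\<integral>x. gauss_kernel P 1 x \<partial>lborel) \<ge> 0"
    using pos by (intro integral_nonneg_AE) (auto simp: less_imp_le)
  ultimately show ?thesis by linarith
qed

text \<open>With a = c t, the bound K1 + K2 / a becomes a function of t integrable under
  \<open>W\<close>, by finiteness and by the inverse moment of \<open>W\<close>; this is the
  absolute integrability Fubini asks for.\<close>

lemma gauss_kernel_mixture:
  fixes P :: "real^'n^'n" and W :: "real measure" and \<Phi> :: "real^'n \<Rightarrow> real"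
  assumes P: "pos_def P" and c: "c > 0"
    and fin: "finite_measure W" and sets: "sets W = sets (restrict_space borel {0<..})"
    and inv_int: "integrable W (\<lambda>t. 1 / t)"
    and \<Phi>[measurable]: "\<Phi> \<in> borel_measurable borel"
    and int: "\<And>a. a > 0 \<Longrightarrow> integrable lborel (\<lambda>x. \<Phi> x * gauss_kernel P a x)"
    and bound: "\<And>a. a > 0 \<Longrightarrow> (\<integral>x. \<bar>\<Phi> x\<bar> * gauss_kernel P a x \<partial>lborel) \<le> K1 + K2 / a"
  shows "integrable lborel (\<lambda>x. \<Phi> x * (\<integral>t. gauss_kernel P (c * t) x \<partial>W))"
    and "(\<integral>x. \<Phi> x * (\<integral>t. gauss_kernel P (c * t) x \<partial>W) \<partial>lborel)
      = (\<integral>t. (\<integral>x. \<Phi> x * gauss_kernel P (c * t) x \<partial>lborel) \<partial>W)"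
proof -
  have space: "space W = {0<..}" using sets_eq_imp_space_eq[OF sets] by (simp add: space_restrict_space)
  interpret W: finite_measure W by (rule fin)
  interpret pair_sigma_finite W "lborel :: (real^'n) measure"
    by (simp add: pair_sigma_finite_def W.sigma_finite_measure_axioms sigma_finite_lborel)
  have idm [measurable]: "(\<lambda>t. t) \<in> borel_measurable W"
    unfolding measurable_cong_sets[OF sets refl] by (intro measurable_restrict_space1) simp
  let ?F = "\<lambda>t x. \<Phi> x * gauss_kernel P (c * t) x"
  have Fm [measurable]: "case_prod ?F \<in> borel_measurable (W \<Otimes>\<^sub>M lborel)"
    unfolding gauss_kernel_def split_beta' by measurable
  have tpos: "c * t > 0" if "t \<in> space W" for t using that c space by simp
  have Fint: "integrable (W \<Otimes>\<^sub>M lborel) (case_prod ?F)"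
  proof (rule Fubini_integrable[OF Fm])
    show "AE t in W. integrable lborel (\<lambda>x. case_prod ?F (t, x))"
      using int tpos by (intro AE_I2) simp
    show "integrable W (\<lambda>t. LINT x|lborel. norm (case_prod ?F (t, x)))"
    proof (rule Bochner_Integration.integrable_bound)
      show "integrable W (\<lambda>t. K1 + K2 / c * (1 / t))"
        by (intro Bochner_Integration.integrable_add integrable_mult_right inv_int W.integrable_const)
      show "(\<lambda>t. LINT x|lborel. norm (case_prod ?F (t, x))) \<in> borel_measurable W"
        by measurable
      show "AE t in W. norm (LINT x|lborel. norm (case_prod ?F (t, x))) \<le> norm (K1 + K2 / c * (1 / t))"
      proof (rule AE_I2)
        fix t assume t: "t \<in> space W"
        have "(LINT x|lborel. norm (case_prod ?F (t, x))) = (\<integral>x. \<bar>\<Phi> x\<bar> * gauss_kernel P (c * t) x \<partial>lborel)"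
          by (simp add: abs_mult gauss_kernel_def)
        also have "\<dots> \<le> K1 + K2 / c * (1 / t)" using bound[OF tpos[OF t]] by simp
        finally show "norm (LINT x|lborel. norm (case_prod ?F (t, x))) \<le> norm (K1 + K2 / c * (1 / t))"
          by (simp add: abs_of_nonneg integral_nonneg_AE)
      qed
    qed
  qed
  show "integrable lborel (\<lambda>x. \<Phi> x * (\<integral>t. gauss_kernel P (c * t) x \<partial>W))"
    using integrable_snd[OF Fint] by simp
  show "(\<integral>x. \<Phi> x * (\<integral>t. gauss_kernel P (c * t) x \<partial>W) \<partial>lborel)
      = (\<integral>t. (\<integral>x. \<Phi> x * gauss_kernel P (c * t) x \<partial>lborel) \<partial>W)"
    using Fubini_integral[OF Fint] by simp
qed

text \<open>Equalities, unlike inequalities, pass to signed mixtures: this is why the Stein identity and not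
  the risk comparison is established for each normal component.\<close>

lemma elliptical_mixture:
  fixes V :: "real^'n^'n" and \<Phi> :: "real^'n \<Rightarrow> real"
  assumes V: "pos_def V" and \<sigma>: "\<sigma> > 0" and g: "g \<in> borel_measurable borel"
    and sm: "signed_mixing Wp Wm" and nm: "normal_mixture V g Wp Wm"
    and m [measurable]: "\<Phi> \<in> borel_measurable borel"
    and int: "\<And>a. a > 0 \<Longrightarrow> integrable lborel (\<lambda>x. \<Phi> x * gauss_kernel (matrix_inv V) a x)"
    and bound: "\<And>a. a > 0 \<Longrightarrow> (\<integral>x. \<bar>\<Phi> x\<bar> * gauss_kernel (matrix_inv V) a x \<partial>lborel) \<le> K1 + K2 / a"
  shows integrable_elliptical_mixture: "integrable lborel (\<lambda>x. \<Phi> x * elliptical_density V \<sigma> g x)"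
    and integral_elliptical_mixture:
      "(\<And>a. a > 0 \<Longrightarrow> (\<integral>x. \<Phi> x * gauss_kernel (matrix_inv V) a x \<partial>lborel) = I) \<Longrightarrow>
        \<exists>\<kappa>>0. (\<integral>x. \<Phi> x * elliptical_density V \<sigma> g x \<partial>lborel) = \<kappa> * I"
proof -
  let ?P = "matrix_inv V"
  have P: "pos_def ?P" by (rule pos_def_matrix_inv[OF V])
  obtain \<kappa> where \<kappa>: "\<kappa> > 0" and mvn:
    "\<And>t x. t > 0 \<Longrightarrow> mvn_density 0 ((\<sigma>\<^sup>2 / t) *\<^sub>R V) x = \<kappa> * gauss_kernel ?P (t / (2 * \<sigma>\<^sup>2)) x"
    using mvn_density_eq_gauss_kernel[OF V \<sigma>] by blast
  define c where "c = 1 / (2 * \<sigma>\<^sup>2)"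
  have c: "c > 0" using \<sigma> by (simp add: c_def)
  have mix: "finite_measure Wp" "sets Wp = sets (restrict_space borel {0<..})" "integrable Wp (\<lambda>t. 1 / t)"
    "finite_measure Wm" "sets Wm = sets (restrict_space borel {0<..})" "integrable Wm (\<lambda>t. 1 / t)"
    and mass: "measure Wp {0<..} - measure Wm {0<..} = 1"
    using sm by (auto simp: signed_mixing_def)
  have space: "space Wp = {0<..}" "space Wm = {0<..}"
    using sets_eq_imp_space_eq[OF mix(2)] sets_eq_imp_space_eq[OF mix(5)] by (simp_all add: space_restrict_space)
  let ?G = "\<lambda>W x. (\<integral>t. gauss_kernel ?P (c * t) x \<partial>W)"
  have G: "(\<integral>t. mvn_density 0 ((\<sigma>\<^sup>2 / t) *\<^sub>R V) x \<partial>W) = \<kappa> * ?G W x" if "space W = {0<..}" for W x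
  proof -
    have "(\<integral>t. mvn_density 0 ((\<sigma>\<^sup>2 / t) *\<^sub>R V) x \<partial>W) = (\<integral>t. \<kappa> * gauss_kernel ?P (c * t) x \<partial>W)"
      by (rule Bochner_Integration.integral_cong) (auto simp: that mvn c_def)
    then show ?thesis by simp
  qed
  have rep: "AE x in lborel. elliptical_density V \<sigma> g x = \<kappa> * (?G Wp x - ?G Wm x)"
    using nm[unfolded normal_mixture_def, rule_format, OF \<sigma>]
    by eventually_elim (simp add: G space right_diff_distrib)
  have fm [measurable]: "elliptical_density V \<sigma> g \<in> borel_measurable borel"
    unfolding elliptical_density_def using g by measurable
    note p = gauss_kernel_mixture[OF P c mix(1-3) m int bound]
    note n = gauss_kernel_mixture[OF P c mix(4-6) m int bound]
    have rep': "AE x in lborel. \<Phi> x * elliptical_density V \<sigma> g x = \<kappa> * (\<Phi> x * ?G Wp x - \<Phi> x * ?G Wm x)"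
      using rep by eventually_elim (simp only: mult.left_commute right_diff_distrib)
    have i: "integrable lborel (\<lambda>x. \<kappa> * (\<Phi> x * ?G Wp x - \<Phi> x * ?G Wm x))"
      using p(1) n(1) by auto
    then have im: "(\<lambda>x. \<kappa> * (\<Phi> x * ?G Wp x - \<Phi> x * ?G Wm x)) \<in> borel_measurable lborel" by auto
    have 1: "integrable lborel (\<lambda>x. \<Phi> x * elliptical_density V \<sigma> g x)"
      by (rule integrable_cong_AE[THEN iffD2, OF _ im rep' i]) simp
    have 2: "(\<integral>x. \<Phi> x * elliptical_density V \<sigma> g x \<partial>lborel)
       = \<kappa> * ((\<integral>t. (\<integral>x. \<Phi> x * gauss_kernel ?P (c * t) x \<partial>lborel) \<partial>Wp) - (\<integral>t. (\<integral>x. \<Phi> x * gauss_kernel ?P (c * t) x \<partial>lborel) \<partial>Wm))"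
      by (subst integral_cong_AE[OF _ im rep']) (simp_all add: p n)
  show "integrable lborel (\<lambda>x. \<Phi> x * elliptical_density V \<sigma> g x)" by (fact 1)
  show "\<exists>\<kappa>>0. (\<integral>x. \<Phi> x * elliptical_density V \<sigma> g x \<partial>lborel) = \<kappa> * I"
    if I: "\<And>a. a > 0 \<Longrightarrow> (\<integral>x. \<Phi> x * gauss_kernel ?P a x \<partial>lborel) = I"
  proof (rule exI[of _ \<kappa>], rule conjI[OF \<kappa>])
    have "(\<integral>t. (\<integral>x. \<Phi> x * gauss_kernel ?P (c * t) x \<partial>lborel) \<partial>W) = measure W {0<..} * I" if "space W = {0<..}" for W
    proof -
      have "(\<integral>t. (\<integral>x. \<Phi> x * gauss_kernel ?P (c * t) x \<partial>lborel) \<partial>W) = (\<integral>t. I \<partial>W)"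
        by (rule Bochner_Integration.integral_cong) (auto simp: that I c)
      then show ?thesis by (simp add: that)
    qed
    then have "(\<integral>x. \<Phi> x * elliptical_density V \<sigma> g x \<partial>lborel) = \<kappa> * ((measure Wp {0<..} - measure Wm {0<..}) * I)"
      using 2 space by (simp add: left_diff_distrib)
    then show "(\<integral>x. \<Phi> x * elliptical_density V \<sigma> g x \<partial>lborel) = \<kappa> * I"
      by (simp add: mass)
  qed
qed

section \<open>The risk gain under an elliptical law\<close>

text \<open>Moving from y to y - t Z y changes the form from 0 to t^2 b - 2 t |Z y|^2. For small t >
  0 the linear term would make it negative unless Z y = 0.\<close>

lemma pos_semidef_kernel:
  fixes Z :: "real^'k^'k"
  assumes sym: "transpose Z = Z" and psd: "\<And>y. y \<bullet> (Z *v y) \<ge> 0" and y: "y \<bullet> (Z *v y) = 0"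
  shows "Z *v y = 0"
proof -
  define w where "w = Z *v y"
  define b where "b = w \<bullet> (Z *v w)"
  have sw: "y \<bullet> (Z *v w) = w \<bullet> w"
    unfolding w_def using sym by (metis dot_lmul_matrix transpose_matrix_vector)
  have ineq: "0 \<le> t\<^sup>2 * b - 2 * t * (w \<bullet> w)" for t
    using psd[of "y - t *\<^sub>R w"] y sw
    by (simp add: matrix_vector_mult_diff_distrib matrix_vector_mult_scaleR inner_diff_left inner_diff_right
        power2_eq_square b_def flip: w_def) (simp add: algebra_simps)
  have b: "b \<ge> 0" by (simp add: b_def psd)
  have "w \<bullet> w \<le> 0"
  proof (rule ccontr)
    assume "\<not> w \<bullet> w \<le> 0"
    then have ww: "w \<bullet> w > 0" by (simp only: not_le)
    \<comment> \<open>The summand 1 keeps the quotient meaningful when b = 0.\<close>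
    define t where "t = (w \<bullet> w) / (b + 1)"
    have t: "t > 0" using ww b by (simp add: t_def)
    have "0 \<le> t * (t * b - 2 * (w \<bullet> w))" using ineq[of t] by (simp add: power2_eq_square algebra_simps)
    then have "2 * (w \<bullet> w) \<le> t * b" using t by (simp add: zero_le_mult_iff)
    also have "\<dots> \<le> t * (b + 1)" using t by simp
    also have "\<dots> = w \<bullet> w" using b by (simp add: t_def)
    finally show False using ww by simp
  qed
  then have "w = 0" by (metis inner_eq_zero_iff inner_ge_zero order_antisym)
  then show ?thesis by (simp add: w_def)
qed

context shrinkage
begin

lemma gauss_kernel_eq: "gauss_kernel P a x = a powr (real CARD('n) / 2) * gw a x"
  by (simp add: gauss_kernel_def gw_def)

lemma integral_gauss_kernel_eq:
  "(\<integral>x. f x * gauss_kernel P a x \<partial>lborel) = a powr (real CARD('n) / 2) * (\<integral>x. f x * gw a x \<partial>lborel)"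
proof -
  have "(\<integral>x. f x * gauss_kernel P a x \<partial>lborel) = (\<integral>x. a powr (real CARD('n) / 2) * (f x * gw a x) \<partial>lborel)"
    by (simp only: gauss_kernel_eq mult.left_commute)
  then show ?thesis by simp
qed

text \<open>The inverse moment is bounded by a multiple of the second moment with a constant free of
  a, so both parts of the majorant scale like 1 / a. The explicit summand 0 fills the slot
  \<open>K1\<close> of the mixture lemmas.\<close>

lemma dominated_moment:
  assumes \<Psi> [measurable]: "\<Psi> \<in> borel_measurable borel"
    and bound: "\<And>x. \<bar>\<Psi> x\<bar> \<le> K * ((norm x)\<^sup>2 + (r x)\<^sup>2 / ell x)"
  obtains K2 where "\<And>a. a > 0 \<Longrightarrow> integrable lborel (\<lambda>x. \<Psi> x * gauss_kernel P a x)"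
    "\<And>a. a > 0 \<Longrightarrow> (\<integral>x. \<bar>\<Psi> x\<bar> * gauss_kernel P a x \<partial>lborel) \<le> 0 + K2 / a"
proof -
  obtain K1 where K1: "K1 \<ge> 0" "\<And>a. a > 0 \<Longrightarrow> integrable lborel (\<lambda>x. (r x)\<^sup>2 / ell x * gw a x)"
    "\<And>a. a > 0 \<Longrightarrow> (\<integral>x. (r x)\<^sup>2 / ell x * gw a x \<partial>lborel) \<le> K1 * (\<integral>x. (norm x)\<^sup>2 * gw a x \<partial>lborel)"
    by (rule inverse_moment) (rule that)
  let ?e = "\<lambda>a. a powr (real CARD('n) / 2)"
  let ?M = "\<integral>x. (norm x)\<^sup>2 * gauss_kernel P 1 x \<partial>lborel"
  define h where "h a x = \<bar>K\<bar> * ((norm x)\<^sup>2 * gauss_kernel P a x) + \<bar>K\<bar> * ?e a * ((r x)\<^sup>2 / ell x * gw a x)" for a x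
  have n: "integrable lborel (\<lambda>x. (norm x)\<^sup>2 * gauss_kernel P a x)" if "a > 0" for a
  proof -
    have "integrable lborel (\<lambda>x. ?e a * ((norm x)\<^sup>2 * gw a x))" using integrable_norm_sq[OF that] by auto
    then show ?thesis by (simp add: gauss_kernel_eq mult_ac)
  qed
  have hi: "integrable lborel (h a)" if "a > 0" for a
    unfolding h_def using that by (intro Bochner_Integration.integrable_add integrable_mult_right n K1(2))
  have gpos: "gauss_kernel P a x \<ge> 0" for a x by (simp add: gauss_kernel_def)
  have hb: "\<bar>\<Psi> x\<bar> * gauss_kernel P a x \<le> h a x" for a x
  proof -
    have "0 \<le> (norm x)\<^sup>2 + (r x)\<^sup>2 / ell x" using ell_nonneg[of x] by simp
    then have "\<bar>\<Psi> x\<bar> \<le> \<bar>K\<bar> * ((norm x)\<^sup>2 + (r x)\<^sup>2 / ell x)"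
      using bound[of x] by (meson abs_ge_self mult_right_mono order_trans)
    then have "\<bar>\<Psi> x\<bar> * gauss_kernel P a x \<le> \<bar>K\<bar> * ((norm x)\<^sup>2 + (r x)\<^sup>2 / ell x) * gauss_kernel P a x"
      by (rule mult_right_mono) (rule gpos)
    also have "\<dots> = h a x" by (simp add: h_def gauss_kernel_eq algebra_simps)
    finally show ?thesis .
  qed
  have i: "integrable lborel (\<lambda>x. \<Psi> x * gauss_kernel P a x)" if "a > 0" for a
    by (rule Bochner_Integration.integrable_bound[OF hi[OF that]])
       (use hb gpos in \<open>auto simp: abs_mult intro!: AE_I2 order_trans[OF _ abs_ge_self]\<close>)
  show ?thesis
  proof (rule that[OF i])
    fix a :: real assume a: "a > 0"
    have i': "integrable lborel (\<lambda>x. \<bar>\<Psi> x\<bar> * gauss_kernel P a x)"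
      using integrable_abs[OF i[OF a]] gpos by (simp add: abs_mult)
    have e1: "(\<integral>x. (norm x)\<^sup>2 * gauss_kernel P a x \<partial>lborel) = ?M / a" by (rule gauss_kernel_moments(2)[OF a])
    have e2: "?e a * (\<integral>x. (norm x)\<^sup>2 * gw a x \<partial>lborel) = ?M / a"
      using integral_gauss_kernel_eq[of "\<lambda>x. (norm x)\<^sup>2" a] e1 by simp
    have ia: "integrable lborel (\<lambda>x. \<bar>K\<bar> * ((norm x)\<^sup>2 * gauss_kernel P a x))"
      and ib: "integrable lborel (\<lambda>x. \<bar>K\<bar> * ?e a * ((r x)\<^sup>2 / ell x * gw a x))"
      by (intro integrable_mult_right n K1(2) a)+
    have "(\<integral>x. \<bar>\<Psi> x\<bar> * gauss_kernel P a x \<partial>lborel) \<le> (\<integral>x. h a x \<partial>lborel)"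
      by (intro integral_mono i' hi a hb)
    also have "\<dots> = \<bar>K\<bar> * (?M / a) + \<bar>K\<bar> * ?e a * (\<integral>x. (r x)\<^sup>2 / ell x * gw a x \<partial>lborel)"
      unfolding h_def Bochner_Integration.integral_add[OF ia ib] integral_mult_right_zero e1 by (rule refl)
    also have "\<dots> \<le> \<bar>K\<bar> * (?M / a) + \<bar>K\<bar> * ?e a * (K1 * (\<integral>x. (norm x)\<^sup>2 * gw a x \<partial>lborel))"
      using a by (intro add_left_mono mult_left_mono K1(3)) auto
    also have "\<dots> = \<bar>K\<bar> * (?M / a) + \<bar>K\<bar> * K1 * (?M / a)" unfolding e2[symmetric] by simp
    also have "\<dots> = 0 + (\<bar>K\<bar> * ?M + \<bar>K\<bar> * K1 * ?M) / a" by (simp add: add_divide_distrib)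
    finally show "(\<integral>x. \<bar>\<Psi> x\<bar> * gauss_kernel P a x \<partial>lborel) \<le> 0 + (\<bar>K\<bar> * ?M + \<bar>K\<bar> * K1 * ?M) / a" .
  qed
qed

lemma elliptical_moments:
  assumes V: "pos_def V" and PV: "P = matrix_inv V" and \<sigma>: "\<sigma> > 0" and g: "g \<in> borel_measurable borel"
    and sm: "signed_mixing Wp Wm" and nm: "normal_mixture V g Wp Wm"
  shows elliptical_integrable: "\<And>\<Psi> K. \<Psi> \<in> borel_measurable borel \<Longrightarrow>
      (\<And>x. \<bar>\<Psi> x\<bar> \<le> K * ((norm x)\<^sup>2 + (r x)\<^sup>2 / ell x)) \<Longrightarrow>
      integrable lborel (\<lambda>x. \<Psi> x * elliptical_density V \<sigma> g x)"
    and elliptical_stein: "N ** B = 0 \<Longrightarrow> (\<integral>x. \<Phi> B x * elliptical_density V \<sigma> g x \<partial>lborel) = 0"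
    and elliptical_mass: "(\<integral>x. elliptical_density V \<sigma> g x \<partial>lborel) > 0"
proof -
  note mixture = integrable_elliptical_mixture[OF V \<sigma> g sm nm, folded PV]
    integral_elliptical_mixture[OF V \<sigma> g sm nm, folded PV]
  show "integrable lborel (\<lambda>x. \<Psi> x * elliptical_density V \<sigma> g x)"
    if m: "\<Psi> \<in> borel_measurable borel" and b: "\<And>x. \<bar>\<Psi> x\<bar> \<le> K * ((norm x)\<^sup>2 + (r x)\<^sup>2 / ell x)" for \<Psi> K
  proof -
    obtain K2 where "\<And>a. a > 0 \<Longrightarrow> integrable lborel (\<lambda>x. \<Psi> x * gauss_kernel P a x)"
      "\<And>a. a > 0 \<Longrightarrow> (\<integral>x. \<bar>\<Psi> x\<bar> * gauss_kernel P a x \<partial>lborel) \<le> 0 + K2 / a"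
      by (rule dominated_moment[OF m b]) (rule that)
    then show ?thesis by (rule mixture(1)[OF m])
  qed
  show "(\<integral>x. \<Phi> B x * elliptical_density V \<sigma> g x \<partial>lborel) = 0" if NB: "N ** B = 0"
  proof -
    obtain K where b: "\<And>x. \<bar>\<Phi> B x\<bar> \<le> K * ((norm x)\<^sup>2 + (r x)\<^sup>2 / ell x)" using \<Phi>_bound[where B=B] by metis
    obtain K2 where "\<And>a. a > 0 \<Longrightarrow> integrable lborel (\<lambda>x. \<Phi> B x * gauss_kernel P a x)"
      "\<And>a. a > 0 \<Longrightarrow> (\<integral>x. \<bar>\<Phi> B x\<bar> * gauss_kernel P a x \<partial>lborel) \<le> 0 + K2 / a"
      by (rule dominated_moment[OF measurable_\<Phi> b]) (rule that)
    moreover have "(\<integral>x. \<Phi> B x * gauss_kernel P a x \<partial>lborel) = 0" if "a > 0" for a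
      using stein[OF NB that] by (simp add: integral_gauss_kernel_eq)
    ultimately have "\<exists>\<kappa>>0. (\<integral>x. \<Phi> B x * elliptical_density V \<sigma> g x \<partial>lborel) = \<kappa> * 0"
      by (rule mixture(2)[OF measurable_\<Phi>])
    then show ?thesis by simp
  qed
  let ?Z = "\<integral>x. gauss_kernel P 1 x \<partial>lborel"
  \<comment> \<open>The constant function 1 fits the bound with \<open>K1 = ?Z\<close> and
    \<open>K2 = 0\<close>. Positive mass later excludes a density that vanishes almost
    everywhere.\<close>
  have "\<exists>\<kappa>>0. (\<integral>x. 1 * elliptical_density V \<sigma> g x \<partial>lborel) = \<kappa> * ?Z"
  proof (rule mixture(2)[where \<Phi> = "\<lambda>_. 1" and ?K1.0 = "?Z" and ?K2.0 = 0])
    fix a :: real assume a: "a > 0"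
    show "integrable lborel (\<lambda>x. 1 * gauss_kernel P a x)"
      unfolding gauss_kernel_eq using gaussian_integrable[OF poly_bounded_const[of 1] a] by auto
    show "(\<integral>x. \<bar>1\<bar> * gauss_kernel P a x \<partial>lborel) \<le> ?Z + 0 / a"
      using gauss_kernel_moments(1)[OF a, of P] by simp
    show "(\<integral>x. 1 * gauss_kernel P a x \<partial>lborel) = ?Z"
      using gauss_kernel_moments(1)[OF a, of P] by simp
  qed simp
  then show "(\<integral>x. elliptical_density V \<sigma> g x \<partial>lborel) > 0"
    using integral_gauss_kernel_pos[OF P] by auto
qed

text \<open>The loss of \<open>beta_tilde\<close> minus that of \<open>beta_S\<close>, as a function
  of the error, for the shrinkage factor c r / ell and the \<open>B\<close> of the theorem.\<close>

definition "risk_gain c B x = 2 * c * (r x * s B x / ell x) - c\<^sup>2 * ((r x)\<^sup>2 * bil B x / (ell x)\<^sup>2)"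

lemma measurable_risk_gain [measurable]: "risk_gain c B \<in> borel_measurable borel"
  unfolding risk_gain_def by measurable

lemma risk_gain_bound:
  obtains K where "\<And>x. \<bar>risk_gain c B x\<bar> \<le> K * ((norm x)\<^sup>2 + (r x)\<^sup>2 / ell x)"
proof -
  obtain K1 where K1: "K1 \<ge> 0" "\<And>x. \<bar>r x * s B x / ell x\<bar> \<le> K1 * (norm x)\<^sup>2 + (r x)\<^sup>2 / ell x"
    using cross_bound[where B=B] by metis
  obtain K2 where K2: "K2 \<ge> 0" "\<And>x. \<bar>bil B x\<bar> \<le> K2 * ell x" using bil_bound by blast
  show ?thesis
  proof (rule that)
    fix x
    let ?e = "(r x)\<^sup>2 / ell x" and ?n = "(norm x)\<^sup>2"
    have e: "0 \<le> ?e" using ell_nonneg[of x] by simp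
    have "\<bar>bil B x / ell x\<bar> \<le> K2"
      using K2 ell_nonneg[of x] by (cases "ell x = 0") (auto simp: pos_divide_le_eq)
    then have "?e * \<bar>bil B x / ell x\<bar> \<le> ?e * K2" using e by (rule mult_left_mono)
    then have 1: "\<bar>(r x)\<^sup>2 * bil B x / (ell x)\<^sup>2\<bar> \<le> ?e * K2"
      using ell_nonneg[of x] by (simp add: abs_mult power2_eq_square)
    have "\<bar>risk_gain c B x\<bar> \<le> \<bar>2 * c * (r x * s B x / ell x)\<bar> + \<bar>c\<^sup>2 * ((r x)\<^sup>2 * bil B x / (ell x)\<^sup>2)\<bar>"
      unfolding risk_gain_def by (rule abs_triangle_ineq4)
    also have "\<dots> = 2 * \<bar>c\<bar> * \<bar>r x * s B x / ell x\<bar> + c\<^sup>2 * \<bar>(r x)\<^sup>2 * bil B x / (ell x)\<^sup>2\<bar>"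
      unfolding abs_mult by simp
    also have "\<dots> \<le> 2 * \<bar>c\<bar> * (K1 * ?n + ?e) + c\<^sup>2 * (?e * K2)"
      using K1(2)[of x] 1 by (intro add_mono mult_left_mono) auto
    also have "\<dots> \<le> (2 * \<bar>c\<bar> * (K1 + 1) + c\<^sup>2 * K2) * (?n + ?e)"
    proof -
      have "0 \<le> 2 * \<bar>c\<bar> * ?n" "0 \<le> 2 * \<bar>c\<bar> * K1 * ?e" "0 \<le> c\<^sup>2 * K2 * ?n"
        using K1(1) K2(1) e by (auto intro!: mult_nonneg_nonneg simp del: times_divide_eq_right)
      then show ?thesis by (simp add: algebra_simps)
    qed
    finally show "\<bar>risk_gain c B x\<bar> \<le> (2 * \<bar>c\<bar> * (K1 + 1) + c\<^sup>2 * K2) * (?n + ?e)" .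
  qed
qed

text \<open>Subtracting a multiple of the centred variable \<open>\<Phi> B\<close> turns the gain into
  \<open>c / (m + 2) * r\<^sup>2 / ell\<^sup>2 * (v \<bullet> Z v)\<close>, which is pointwise nonnegative and vanishes on a null set
  only; no sign of the mixing measure is needed.\<close>

lemma risk_gain_pos:
  fixes Z :: "real^'q^'q"
  assumes V: "pos_def V" and PV: "P = matrix_inv V" and \<sigma>: "\<sigma> > 0" and g: "g \<in> borel_measurable borel"
    and g_nonneg: "\<And>x. elliptical_density V \<sigma> g x \<ge> 0"
    and sm: "signed_mixing Wp Wm" and nm: "normal_mixture V g Wp Wm"
    and NB: "N ** B = 0" and m: "m > 0" and c: "c = (real CARD('q) - 2) / (m + 2)"
    and Z: "transpose Z = Z" "\<And>y. y \<bullet> (Z *v y) \<ge> 0" "Z \<noteq> 0"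
    and Z_eq: "\<And>x. v x \<bullet> (Z *v v x) = 2 * trace (L ** B) * ell x - (real CARD('q) + 2) * bil B x"
  shows "(\<integral>x. risk_gain c B x * elliptical_density V \<sigma> g x \<partial>lborel) > 0"
proof -
  let ?f = "elliptical_density V \<sigma> g"
  note em = V PV \<sigma> g sm nm
  define k where "k = c / (m + 2)"
  define G where "G x = (r x)\<^sup>2 / (ell x)\<^sup>2 * (v x \<bullet> (Z *v v x))" for x
  have cpos: "c > 0" using c m q3 by simp
  then have k: "k > 0" using m by (simp add: k_def)
  have gain: "risk_gain c B x = k * G x + 2 * k * \<Phi> B x" for x
  proof -
    have c': "c = k * (m + 2)" "k * (real CARD('q) - 2) = c\<^sup>2"
      using m by (simp_all add: k_def c power2_eq_square)
    \<comment> \<open>Splits q + 2 as (q - 2) + 4: the first part becomes the c^2 term of the gain,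
      the second is the quadratic term of 2 k \<Phi>.\<close>
    have split: "k * (2 * t - (z + 2) * b) = 2 * k * t - k * (z - 2) * b - 4 * k * b" for t b z
      by (simp add: algebra_simps)
    have el: "(r x)\<^sup>2 / (ell x)\<^sup>2 * (t * ell x) = (r x)\<^sup>2 * (t / ell x)" for t
      by (simp add: power2_eq_square)
    have "k * G x = k * (2 * ((r x)\<^sup>2 * (trace (L ** B) / ell x))
        - (real CARD('q) + 2) * ((r x)\<^sup>2 * bil B x / (ell x)\<^sup>2))"
      unfolding G_def Z_eq right_diff_distrib el by (simp add: mult_ac)
    also have "\<dots> = 2 * k * ((r x)\<^sup>2 * (trace (L ** B) / ell x)) - k * (real CARD('q) - 2) * ((r x)\<^sup>2 * bil B x / (ell x)\<^sup>2)
        - 4 * k * ((r x)\<^sup>2 * bil B x / (ell x)\<^sup>2)"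
      by (rule split)
    finally have 1: "k * G x = 2 * k * ((r x)\<^sup>2 * (trace (L ** B) / ell x)) - c\<^sup>2 * ((r x)\<^sup>2 * bil B x / (ell x)\<^sup>2)
        - 4 * k * ((r x)\<^sup>2 * bil B x / (ell x)\<^sup>2)"
      unfolding c'(2) .
    have 2: "2 * k * \<Phi> B x = 2 * (k * (m + 2)) * (r x * s B x / ell x) - 2 * k * ((r x)\<^sup>2 * (trace (L ** B) / ell x))
        + 4 * k * ((r x)\<^sup>2 * bil B x / (ell x)\<^sup>2)"
      unfolding \<Phi>_def by (simp add: algebra_simps)
    show ?thesis unfolding risk_gain_def 1 2 c'(1)[symmetric] by simp
  qed
  obtain K1 where K1: "\<And>x. \<bar>risk_gain c B x\<bar> \<le> K1 * ((norm x)\<^sup>2 + (r x)\<^sup>2 / ell x)"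
    using risk_gain_bound by blast
  obtain K2 where K2: "\<And>x. \<bar>\<Phi> B x\<bar> \<le> K2 * ((norm x)\<^sup>2 + (r x)\<^sup>2 / ell x)"
    using \<Phi>_bound[where B=B] by metis
  have i1: "integrable lborel (\<lambda>x. risk_gain c B x * ?f x)"
    by (rule elliptical_integrable[OF em measurable_risk_gain K1])
  have i2: "integrable lborel (\<lambda>x. \<Phi> B x * ?f x)"
    by (rule elliptical_integrable[OF em measurable_\<Phi> K2])
  have eq: "k * (G x * ?f x) = risk_gain c B x * ?f x - 2 * k * (\<Phi> B x * ?f x)" for x
    by (simp add: gain algebra_simps)
  have "integrable lborel (\<lambda>x. inverse k * (k * (G x * ?f x)))"
    unfolding eq by (intro integrable_mult_right Bochner_Integration.integrable_diff i1 i2)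
  then have iG: "integrable lborel (\<lambda>x. G x * ?f x)" using k by simp
  have "(\<integral>x. k * (G x * ?f x) \<partial>lborel) = (\<integral>x. risk_gain c B x * ?f x \<partial>lborel) - 2 * k * (\<integral>x. \<Phi> B x * ?f x \<partial>lborel)"
    unfolding eq using i1 i2 by (subst Bochner_Integration.integral_diff) auto
  then have gainG: "(\<integral>x. risk_gain c B x * ?f x \<partial>lborel) = k * (\<integral>x. G x * ?f x \<partial>lborel)"
    using elliptical_stein[OF em NB] by simp
  have Gf: "G x * ?f x \<ge> 0" for x
    unfolding G_def using Z(2) g_nonneg by (intro mult_nonneg_nonneg) auto
  have "(\<integral>x. G x * ?f x \<partial>lborel) \<noteq> 0"
  proof
    assume "(\<integral>x. G x * ?f x \<partial>lborel) = 0"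
    then have z: "AE x in lborel. G x * ?f x = 0"
      using integral_nonneg_eq_0_iff_AE[OF iG] Gf by simp
    have "N \<noteq> 0" using m by (auto simp: trace_def)
    then have n: "AE x in lborel. N *v x \<noteq> 0" by (rule AE_not_affine_preimage)
    have "Z ** L \<noteq> 0"
    proof
      assume "Z ** L = 0"
      then have "Z ** (L ** B0) = 0" by (simp add: matrix_mul_assoc)
      then show False using LB0 Z(3) by simp
    qed
    then have zl: "AE x in lborel. (Z ** L) *v x \<noteq> - (Z *v v0)" by (rule AE_not_affine_preimage)
    \<comment> \<open>Off these null sets \<open>r\<close>, \<open>ell\<close> and the form of
      \<open>Z\<close> at \<open>v\<close> are all nonzero, so the density itself would have to
      vanish, against its positive mass.\<close>
    have "AE x in lborel. ?f x = 0"
      using z n zl AE_ell_nonzero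
    proof eventually_elim
      fix x assume 1: "G x * ?f x = 0" and 2: "N *v x \<noteq> 0" and 3: "(Z ** L) *v x \<noteq> - (Z *v v0)"
        and 4: "ell x \<noteq> 0"
      have "r x \<noteq> 0" using 2 P unfolding r_def pos_def_def by (metis less_irrefl)
      moreover have "Z *v v x \<noteq> 0"
      proof
        assume "Z *v v x = 0"
        then have "Z *v v0 + (Z ** L) *v x = 0"
          by (simp add: v_def matrix_vector_right_distrib matrix_vector_mul_assoc)
        then show False using 3 by (simp add: add_eq_0_iff)
      qed
      then have "v x \<bullet> (Z *v v x) \<noteq> 0" using pos_semidef_kernel[OF Z(1,2)] by blast
      ultimately show "?f x = 0" using 1 4 by (simp add: G_def)
    qed
    then have "(\<integral>x. ?f x \<partial>lborel) = 0" by (rule integral_eq_zero_AE)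
    then show False using elliptical_mass[OF em] by simp
  qed
  moreover have "(\<integral>x. G x * ?f x \<partial>lborel) \<ge> 0" using Gf by (intro integral_nonneg_AE) auto
  ultimately show ?thesis unfolding gainG using k by simp
qed

end

section \<open>Quadratic forms in canonical coordinates\<close>

lemma inner_matrix_transpose:
  fixes A :: "real^'a^'b"
  shows "(A *v x) \<bullet> y = x \<bullet> (transpose A *v y)"
  by (metis dot_lmul_matrix inner_commute transpose_matrix_vector)

lemma inner_symmetric_matrix: "transpose A = A \<Longrightarrow> (A *v x) \<bullet> y = x \<bullet> (A *v y)" for A :: "real^'a^'a"
  by (simp add: inner_matrix_transpose)

text \<open>Eigenvectors of distinct eigenvalues are orthogonal, and an orthogonal family in a
  finite-dimensional space is finite. This gives the \<open>Max\<close> in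
  \<open>max_eigenvalue\<close> its intended meaning.\<close>

lemma finite_eigenvalues_symmetric:
  fixes A :: "real^'k^'k"
  assumes sym: "transpose A = A"
  shows "finite {l. \<exists>v. v \<noteq> 0 \<and> A *v v = l *\<^sub>R v}" (is "finite ?E")
proof -
  define w where "w l = (SOME v. v \<noteq> 0 \<and> A *v v = l *\<^sub>R v)" for l
  have w: "w l \<noteq> 0" "A *v w l = l *\<^sub>R w l" if "l \<in> ?E" for l
    using someI_ex[of "\<lambda>v. v \<noteq> 0 \<and> A *v v = l *\<^sub>R v"] that by (auto simp: w_def)
  have orth: "w l \<bullet> w l' = 0" if "l \<in> ?E" "l' \<in> ?E" "l \<noteq> l'" for l l'
    using inner_symmetric_matrix[OF sym, of "w l" "w l'"] w(2) that by simp
  have inj: "inj_on w ?E"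
    by (rule inj_onI) (metis (no_types, lifting) inner_eq_zero_iff orth w(1))
  have "pairwise orthogonal (w ` ?E)"
    unfolding pairwise_def orthogonal_def using orth by blast
  then have "finite (w ` ?E)" by (rule pairwise_orthogonal_imp_finite)
  with inj show ?thesis by (simp add: finite_image_iff)
qed

text \<open>Let l be the maximum of the quadratic form on the unit sphere, attained at u. The form
  of l I - A is nonnegative and vanishes at u, so \<open>pos_semidef_kernel\<close> makes u an
  eigenvector with eigenvalue l.\<close>

lemma max_eigenvalue_upper_bound:
  fixes A :: "real^'k^'k"
  assumes sym: "transpose A = A"
  shows "x \<bullet> (A *v x) \<le> max_eigenvalue A * (norm x)\<^sup>2"
proof -
  let ?S = "sphere (0::real^'k) 1"
  have cont: "continuous_on ?S (\<lambda>x. x \<bullet> (A *v x))" by (intro continuous_intros matrix_vector_mult_linear_continuous_on)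
  obtain u where u: "u \<in> ?S" "\<And>x. x \<in> ?S \<Longrightarrow> x \<bullet> (A *v x) \<le> u \<bullet> (A *v u)"
    using continuous_attains_sup[OF compact_sphere _ cont] by auto
  define l where "l = u \<bullet> (A *v u)"
  have le: "x \<bullet> (A *v x) \<le> l * (norm x)\<^sup>2" for x
  proof (cases "x = 0")
    case False
    have "(x \<bullet> (A *v x)) / (norm x)\<^sup>2 = (x /\<^sub>R norm x) \<bullet> (A *v (x /\<^sub>R norm x))"
      by (simp add: matrix_vector_mult_scaleR power2_eq_square divide_inverse)
    also have "\<dots> \<le> l" using u(2)[of "x /\<^sub>R norm x"] False by (simp add: l_def)
    finally show ?thesis using False by (simp add: pos_divide_le_eq)
  qed simp
  define Z where "Z = mat l - A"
  have "mat l *v y = l *\<^sub>R y" for y :: "real^'k"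
    by (simp add: vec_eq_iff matrix_vector_mult_def mat_def if_distrib[of "\<lambda>z. z * _"] cong: if_cong)
  then have Zv: "Z *v y = l *\<^sub>R y - A *v y" for y
    by (simp add: Z_def matrix_vector_mult_diff_rdistrib)
  have "transpose Z = Z" using sym by (auto simp: Z_def transpose_def vec_eq_iff mat_def)
  moreover have "y \<bullet> (Z *v y) \<ge> 0" for y
    using le[of y] by (simp add: Zv inner_diff_right power2_norm_eq_inner)
  moreover have "u \<bullet> (Z *v u) = 0"
    using u(1) by (simp add: Zv inner_diff_right l_def norm_eq_1)
  ultimately have "Z *v u = 0" by (rule pos_semidef_kernel)
  then have "A *v u = l *\<^sub>R u" by (simp add: Zv)
  moreover have "u \<noteq> 0" using u(1) by auto
  ultimately have "l \<le> max_eigenvalue A"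
    unfolding max_eigenvalue_def by (intro Max_ge finite_eigenvalues_symmetric sym) auto
  then have "l * (norm x)\<^sup>2 \<le> max_eigenvalue A * (norm x)\<^sup>2" by (rule mult_right_mono) simp
  with le[of x] show ?thesis by linarith
qed

section \<open>Leading blocks and congruences\<close>

lemma sum_inj_range:
  fixes f :: "'p::finite \<Rightarrow> real" and \<iota> :: "'q::finite \<Rightarrow> 'p"
  assumes "inj \<iota>" "\<And>j. j \<notin> range \<iota> \<Longrightarrow> f j = 0"
  shows "sum f UNIV = (\<Sum>i\<in>UNIV. f (\<iota> i))"
proof -
  have "sum f UNIV = sum f (range \<iota>)" by (rule sum.mono_neutral_right) (use assms in auto)
  also have "\<dots> = (\<Sum>i\<in>UNIV. f (\<iota> i))" using assms(1) by (simp add: sum.reindex)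
  finally show ?thesis .
qed

lemma lead_block_quad_form:
  fixes A :: "real^'p^'p" and \<iota> :: "'q::finite \<Rightarrow> 'p" and x :: "real^'p"
  assumes "inj \<iota>" and x: "\<And>j. j \<notin> range \<iota> \<Longrightarrow> x $ j = 0"
  shows "x \<bullet> (A *v x) = (\<chi> i. x $ \<iota> i) \<bullet> (lead_block \<iota> A *v (\<chi> i. x $ \<iota> i))"
    and "x \<bullet> x = (\<chi> i. x $ \<iota> i) \<bullet> (\<chi> i. x $ \<iota> i)"
proof -
  have "(A *v x) $ j = (\<Sum>k\<in>UNIV. A $ j $ \<iota> k * x $ \<iota> k)" for j
    unfolding matrix_vector_mult_def vec_lambda_beta by (rule sum_inj_range[OF assms(1)]) (simp add: x)
  note * = this
  show "x \<bullet> (A *v x) = (\<chi> i. x $ \<iota> i) \<bullet> (lead_block \<iota> A *v (\<chi> i. x $ \<iota> i))"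
    unfolding inner_vec_def * by (subst sum_inj_range[OF assms(1)])
      (simp_all add: x lead_block_def matrix_vector_mult_def)
  show "x \<bullet> x = (\<chi> i. x $ \<iota> i) \<bullet> (\<chi> i. x $ \<iota> i)"
    unfolding inner_vec_def by (subst sum_inj_range[OF assms(1)]) (simp_all add: x)
qed

lemma trace_mult_lead_id:
  fixes A :: "real^'p^'p" and \<iota> :: "'q::finite \<Rightarrow> 'p"
  assumes "inj \<iota>"
  shows "trace (A ** lead_id \<iota>) = trace (lead_block \<iota> A)"
proof -
  have "(A ** lead_id \<iota>) $ i $ i = (if i \<in> range \<iota> then A $ i $ i else 0)" for i
  proof -
    have "(A ** lead_id \<iota>) $ i $ i = (\<Sum>k\<in>UNIV. if k = i then (if i \<in> range \<iota> then A $ i $ i else 0) else 0)"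
      unfolding matrix_matrix_mult_def lead_id_def vec_lambda_beta by (rule sum.cong) auto
    then show ?thesis by simp
  qed
  then have "trace (A ** lead_id \<iota>) = (\<Sum>i\<in>UNIV. if i \<in> range \<iota> then A $ i $ i else 0)"
    by (simp add: trace_def)
  also have "\<dots> = trace (lead_block \<iota> A)"
    by (subst sum_inj_range[OF assms]) (simp_all add: trace_def lead_block_def)
  finally show ?thesis .
qed

lemma pos_def_lead_block:
  fixes A :: "real^'p^'p" and \<iota> :: "'q::finite \<Rightarrow> 'p"
  assumes "inj \<iota>" "pos_def A"
  shows "pos_def (lead_block \<iota> A)"
proof -
  have "transpose A = A" using assms(2) by (simp add: pos_def_def)
  then have "A $ j $ i = A $ i $ j" for i j by (metis transpose_def vec_lambda_beta)
  then have "transpose (lead_block \<iota> A) = lead_block \<iota> A"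
    by (simp add: transpose_def lead_block_def)
  moreover have "z \<bullet> (lead_block \<iota> A *v z) > 0" if "z \<noteq> 0" for z
  proof -
    define x :: "real^'p" where "x = (\<chi> j. if j \<in> range \<iota> then z $ inv \<iota> j else 0)"
    have z: "z = (\<chi> i. x $ \<iota> i)" using assms(1) by (simp add: x_def)
    then have "x \<noteq> 0" using that by (auto simp: vec_eq_iff)
    then have "x \<bullet> (A *v x) > 0" using assms(2) by (simp add: pos_def_def)
    then show ?thesis
      unfolding z using lead_block_quad_form(1)[OF assms(1), of x A] by (simp add: x_def)
  qed
  ultimately show ?thesis by (simp add: pos_def_def)
qed

lemma pos_def_congruence:
  fixes W :: "real^'k^'k" and F :: "real^'l^'k"
  assumes W: "pos_def W" and inj: "\<And>x. F *v x = 0 \<Longrightarrow> x = 0"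
  shows "pos_def (transpose F ** W ** F)"
proof -
  have "transpose W = W" using W by (simp add: pos_def_def)
  then have "transpose (transpose F ** W ** F) = transpose F ** W ** F"
    by (simp add: matrix_transpose_mul transpose_transpose matrix_mul_assoc)
  moreover have "x \<bullet> ((transpose F ** W ** F) *v x) = (F *v x) \<bullet> (W *v (F *v x))" for x
    by (simp add: inner_matrix_transpose matrix_vector_mul_assoc matrix_mul_assoc)
  ultimately show ?thesis using W inj unfolding pos_def_def by metis
qed

lemma rank_full_injective:
  fixes F :: "real^'k^'l"
  assumes "rank F = CARD('k)" "F *v x = 0"
  shows "x = 0"
  using assms full_rank_injective[of F] by (metis injD matrix_vector_mult_0_right)

lemma pos_def_trace_pos:
  fixes A :: "real^'k^'k"
  assumes "pos_def A"
  shows "trace A > 0"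
proof -
  have "A $ i $ i > 0" for i
  proof -
    have "axis i 1 \<bullet> (A *v axis i (1::real)) > 0"
      using assms unfolding pos_def_def by (metis axis_eq_0_iff zero_neq_one)
    then show ?thesis by (simp add: matrix_vector_mult_basis column_def inner_axis')
  qed
  then show ?thesis unfolding trace_def by (intro sum_pos) auto
qed

text \<open>The trace identity is cyclicity of the trace. For the forms, put F = R H' U and x = Q F
  y. The projection M = R H' U H R fixes F and becomes diag(I, 0) under Q, so x is supported on the
  leading coordinates and z is its restriction to them. Lengths match because F' F = U, and J y = R
  Q' x turns \<open>W\<close> into the leading block.\<close>

lemma restricted_forms:
  fixes C R Q W :: "real^'p^'p" and H :: "real^'p^'q" and U :: "real^'q^'q" and \<iota> :: "'q \<Rightarrow> 'p"
  assumes R: "is_inv_sqrt R C" and G: "invertible (H ** matrix_inv C ** transpose H)"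
    and U: "U = matrix_inv (H ** matrix_inv C ** transpose H)"
    and \<iota>: "inj \<iota>" and Q: "orthogonal_matrix Q"
    and proj: "Q ** (R ** transpose H ** U ** H ** R) ** transpose Q = lead_id \<iota>"
    and A11: "A11 = lead_block \<iota> (Q ** R ** W ** R ** transpose Q)"
    and J: "J = matrix_inv C ** transpose H ** U"
  shows "trace (H ** matrix_inv C ** W ** J) = trace A11"
    and "\<exists>z. y \<bullet> (U *v y) = z \<bullet> z \<and> (J *v y) \<bullet> (W *v (J *v y)) = z \<bullet> (A11 *v z)"
proof -
  have RR: "R ** R = matrix_inv C" and Rs: "transpose R = R"
    using R by (auto simp: is_inv_sqrt_def pos_def_def)
  have QQ: "transpose Q ** Q = mat 1" using Q by (simp add: orthogonal_matrix)
  note GU = matrix_inv_right_left(1)[OF G, folded U]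
  let ?M = "R ** transpose H ** U ** H ** R"
  let ?A = "Q ** R ** W ** R ** transpose Q"
  have "transpose Q ** lead_id \<iota> ** Q = (transpose Q ** Q) ** ?M ** (transpose Q ** Q)"
    unfolding proj[symmetric] by (simp only: matrix_mul_assoc)
  then have M: "?M = transpose Q ** lead_id \<iota> ** Q" by (simp add: QQ)
  have "H ** matrix_inv C ** W ** J = (H ** R) ** (R ** W ** R ** (R ** transpose H ** U))"
    unfolding J RR[symmetric] by (simp only: matrix_mul_assoc)
  then have "trace (H ** matrix_inv C ** W ** J) = trace ((R ** W ** R ** (R ** transpose H ** U)) ** (H ** R))"
    by (rule ssubst) (rule trace_mul_sym)
  also have "(R ** W ** R ** (R ** transpose H ** U)) ** (H ** R) = R ** W ** R ** ?M"
    by (simp only: matrix_mul_assoc)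
  also have "\<dots> = (R ** W ** R ** transpose Q ** lead_id \<iota>) ** Q"
    unfolding M by (simp only: matrix_mul_assoc)
  also have "trace \<dots> = trace (Q ** (R ** W ** R ** transpose Q ** lead_id \<iota>))"
    by (rule trace_mul_sym)
  also have "Q ** (R ** W ** R ** transpose Q ** lead_id \<iota>) = ?A ** lead_id \<iota>"
    by (simp only: matrix_mul_assoc)
  also have "trace \<dots> = trace A11" unfolding A11 by (rule trace_mult_lead_id[OF \<iota>])
  finally show "trace (H ** matrix_inv C ** W ** J) = trace A11" .
  let ?F = "R ** transpose H ** U"
  define x where "x = (Q ** ?F) *v y"
  have "?M ** ?F = ?F ** (H ** (R ** R) ** transpose H ** U)" by (simp only: matrix_mul_assoc)
  also have "\<dots> = ?F" unfolding RR GU by simp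
  finally have MF: "?M ** ?F = ?F" .
  have "lead_id \<iota> ** (Q ** ?F) = Q ** ?M ** (transpose Q ** Q) ** ?F"
    unfolding proj[symmetric] by (simp only: matrix_mul_assoc)
  also have "\<dots> = Q ** (?M ** ?F)" unfolding QQ by (simp add: matrix_mul_assoc)
  finally have lx: "lead_id \<iota> *v x = x" unfolding MF x_def by (simp add: matrix_vector_mul_assoc)
  have x0: "x $ j = 0" if "j \<notin> range \<iota>" for j
  proof -
    have "(lead_id \<iota> *v x) $ j = 0"
      unfolding matrix_vector_mult_def lead_id_def vec_lambda_beta using that by (intro sum.neutral) auto
    then show ?thesis unfolding lx .
  qed
  \<comment> \<open>The direct computation gives \<open>transpose U\<close>; symmetry of F' F then
    replaces it by \<open>U\<close>.\<close>
  have FF: "transpose ?F ** ?F = U"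
  proof -
    have Us: "transpose U ** (H ** (R ** R) ** transpose H ** U) = transpose U" unfolding RR GU by simp
    have "transpose ?F ** ?F = transpose U ** (H ** (R ** R) ** transpose H ** U)"
      by (simp only: matrix_transpose_mul transpose_transpose Rs matrix_mul_assoc)
    then have 1: "transpose ?F ** ?F = transpose U" unfolding Us .
    then have "transpose (transpose ?F ** ?F) = U" by (simp add: transpose_transpose)
    then show ?thesis by (simp add: matrix_transpose_mul transpose_transpose)
  qed
  have "x \<bullet> x = y \<bullet> ((transpose (Q ** ?F) ** (Q ** ?F)) *v y)"
    unfolding x_def by (simp add: inner_matrix_transpose matrix_vector_mul_assoc)
  also have "transpose (Q ** ?F) ** (Q ** ?F) = transpose ?F ** (transpose Q ** Q) ** ?F"
    unfolding matrix_transpose_mul[of Q] by (simp only: matrix_mul_assoc)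
  also have "\<dots> = U" unfolding QQ by (simp add: FF)
  finally have xx: "x \<bullet> x = y \<bullet> (U *v y)" .
  have "(R ** transpose Q) *v x = (R ** (transpose Q ** Q) ** ?F) *v y"
    unfolding x_def matrix_vector_mul_assoc by (simp only: matrix_mul_assoc)
  also have "\<dots> = J *v y" unfolding QQ J RR[symmetric] by (simp add: matrix_mul_assoc)
  finally have Jy: "J *v y = (R ** transpose Q) *v x" by simp
  have "(J *v y) \<bullet> (W *v (J *v y)) = x \<bullet> ((transpose (R ** transpose Q) ** W ** (R ** transpose Q)) *v x)"
    unfolding Jy inner_matrix_transpose by (simp add: matrix_vector_mul_assoc matrix_mul_assoc)
  also have "transpose (R ** transpose Q) ** W ** (R ** transpose Q) = ?A"
    by (simp only: matrix_transpose_mul transpose_transpose Rs matrix_mul_assoc)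
  finally have "(J *v y) \<bullet> (W *v (J *v y)) = x \<bullet> (?A *v x)" .
  then show "\<exists>z. y \<bullet> (U *v y) = z \<bullet> z \<and> (J *v y) \<bullet> (W *v (J *v y)) = z \<bullet> (A11 *v z)"
    using lead_block_quad_form(1)[OF \<iota> x0, of ?A] lead_block_quad_form(2)[OF \<iota> x0] xx
    unfolding A11 by (intro exI[of _ "\<chi> i. x $ \<iota> i"]) simp
qed

section \<open>Dominance\<close>

lemma quad_form_diff:
  fixes W :: "real^'k^'k"
  assumes "transpose W = W"
  shows "(a - k *\<^sub>R j) \<bullet> (W *v (a - k *\<^sub>R j)) = a \<bullet> (W *v a) - (2 * k * (a \<bullet> (W *v j)) - k\<^sup>2 * (j \<bullet> (W *v j)))"
proof -
  have "j \<bullet> (W *v a) = a \<bullet> (W *v j)" using inner_symmetric_matrix[OF assms, of j a] by (simp add: inner_commute)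
  then show ?thesis
    by (simp add: matrix_vector_mult_diff_distrib matrix_vector_mult_scaleR inner_diff_left inner_diff_right
        power2_eq_square algebra_simps)
qed

lemma matrix_diff_distrib:
  fixes A B :: "real^'k^'l" and D E :: "real^'m^'k"
  shows "(A - B) ** D = A ** D - B ** D" and "A ** (D - E) = A ** D - A ** E"
  by (simp_all add: vec_eq_iff matrix_matrix_mult_def algebra_simps sum_subtractf)

lemma transpose_diff: "transpose (A - B) = transpose A - transpose B" for A B :: "real^'k^'l"
  by (simp add: transpose_def vec_eq_iff)

lemma elliptical_density_nonneg:
  assumes "pos_def V" and "\<forall>u\<ge>0. g u \<ge> 0"
  shows "elliptical_density V \<sigma> g x \<ge> 0"
proof -
  have "x \<bullet> (matrix_inv V *v x) \<ge> 0"
    using pos_def_matrix_inv[OF assms(1)] unfolding pos_def_def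
    by (metis inner_zero_left less_imp_le order_refl)
  then show ?thesis using assms(2) by (simp add: elliptical_density_def)
qed

lemma
  fixes f :: "real^'n \<Rightarrow> real"
  assumes "pos_def V" "\<forall>u\<ge>0. g u \<ge> 0" "g \<in> borel_measurable borel" and f: "f \<in> borel_measurable borel"
  shows integrable_elliptical_iff:
      "integrable (elliptical V \<sigma> g) f \<longleftrightarrow> integrable lborel (\<lambda>x. f x * elliptical_density V \<sigma> g x)"
    and integral_elliptical_eq:
      "(\<integral>x. f x \<partial>elliptical V \<sigma> g) = (\<integral>x. f x * elliptical_density V \<sigma> g x \<partial>lborel)"
proof -
  have m: "elliptical_density V \<sigma> g \<in> borel_measurable lborel"
    unfolding elliptical_density_def using assms(3) by measurable
  have n: "AE x in lborel. 0 \<le> elliptical_density V \<sigma> g x"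
    using elliptical_density_nonneg[OF assms(1,2)] by simp
  show "integrable (elliptical V \<sigma> g) f \<longleftrightarrow> integrable lborel (\<lambda>x. f x * elliptical_density V \<sigma> g x)"
    unfolding elliptical_def using integrable_density[of f lborel, OF _ m n] f by (simp add: mult.commute)
  show "(\<integral>x. f x \<partial>elliptical V \<sigma> g) = (\<integral>x. f x * elliptical_density V \<sigma> g x \<partial>lborel)"
    unfolding elliptical_def using integral_density[of f lborel, OF _ m n] f by (simp add: mult.commute)
qed

theorem mainTheorem6:
  fixes X :: "real ^ 'p ^ 'n" and V :: "real ^ 'n ^ 'n" and W :: "real ^ 'p ^ 'p"
    and H :: "real ^ 'p ^ 'q" and h :: "real ^ 'q"
    and g :: "real \<Rightarrow> real" and Wp Wm :: "real measure"
    and R Q A :: "real ^ 'p ^ 'p" and A11 :: "real ^ 'q ^ 'q" and \<iota> :: "'q \<Rightarrow> 'p"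
    and m d :: real
  assumes "CARD('p) < CARD('n)" and "rank X = CARD('p)"
    and "pos_def V"
    and "g \<in> borel_measurable borel" and "\<forall>u\<ge>0. g u \<ge> 0"
    and "signed_mixing Wp Wm" and "normal_mixture V g Wp Wm"
    and "CARD('q) < CARD('p)" and "rank H = CARD('q)"
    and "pos_def W"
    and "CARD('q) \<ge> 3"
    and "m = real CARD('n) - real CARD('p)"
    and "d = (real CARD('q) - 2) * m / (real CARD('q) * (m + 2))"
    and "is_inv_sqrt R (gram X V)"
    and "inj \<iota>"
    and "orthogonal_matrix Q"
    and "Q ** (R ** transpose H ** V1 X V H ** H ** R) ** transpose Q = lead_id \<iota>"
    and "A = Q ** R ** W ** R ** transpose Q"
    and "A11 = lead_block \<iota> A"
    and "trace A11 / max_eigenvalue A11 \<ge> (real CARD('q) + 2) / 2"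
  shows "\<forall>\<beta> :: real ^ 'p. \<forall>\<sigma>>0.
           finite_risk W X V g (beta_tilde X V) \<beta> \<sigma> \<and>
           finite_risk W X V g (beta_S d X V H h) \<beta> \<sigma> \<and>
           risk W X V g (beta_tilde X V) \<beta> \<sigma> - risk W X V g (beta_S d X V H h) \<beta> \<sigma> > 0"
proof (intro allI impI)
  fix \<beta> :: "real ^ 'p" and \<sigma> :: real assume \<sigma>: "\<sigma> > 0"
  define P where "P = matrix_inv V"
  define C where "C = gram X V"
  define Ci where "Ci = matrix_inv C"
  define T where "T = Ci ** transpose X ** P"
  define N where "N = mat 1 - X ** T"
  define U where "U = V1 X V H"
  define J where "J = Ci ** transpose H ** U"
  define G where "G = H ** Ci ** transpose H"
  \<comment> \<open>Chosen so that P B = T' W J: pairing \<open>B *v y\<close> with the error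
    through \<open>P\<close> is the \<open>W\<close>-pairing of the estimation error T x with J y.
    The auxiliary \<open>B0\<close> is X J, a right inverse of \<open>L\<close>.\<close>
  define B where "B = X ** Ci ** W ** J"
  define B0 where "B0 = X ** Ci ** transpose H ** U"
  define L where "L = H ** T"
  define v0 where "v0 = H *v \<beta> - h"
  define \<tau> where "\<tau> = trace A11"
  define q where "q = real CARD('q)"
  define Z where "Z = (2 * \<tau>) *\<^sub>R U - (q + 2) *\<^sub>R (transpose J ** W ** J)"
  define c where "c = (q - 2) / (m + 2)"
  have q: "q \<ge> 3" using assms(11) by (simp add: q_def)
  have m: "m > 0" using assms(1,12) by simp
  have P: "pos_def P" unfolding P_def by (rule pos_def_matrix_inv[OF assms(3)])
  have Ps: "transpose P = P" and Ws: "transpose W = W" using P assms(10) by (auto simp: pos_def_def)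
  have C_eq: "C = transpose X ** P ** X" by (simp add: C_def gram_def P_def)
  have C: "pos_def C" unfolding C_eq by (rule pos_def_congruence[OF P rank_full_injective[OF assms(2)]])
  have Ci: "pos_def Ci" unfolding Ci_def by (rule pos_def_matrix_inv[OF C])
  have Cis: "transpose Ci = Ci" using Ci by (simp add: pos_def_def)
  note CiC = matrix_inv_right_left(2)[OF pos_def_invertible[OF C], folded Ci_def]
  have rk: "rank (transpose H) = CARD('q)" using assms(9) by (simp add: rank_transpose)
  have "pos_def (transpose (transpose H) ** Ci ** transpose H)"
    by (rule pos_def_congruence[OF Ci rank_full_injective[OF rk]])
  then have G: "pos_def G" by (simp add: G_def transpose_transpose)
  have U_eq: "U = matrix_inv G" by (simp add: U_def V1_def G_def Ci_def C_def)
  have U: "pos_def U" unfolding U_eq by (rule pos_def_matrix_inv[OF G])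
  have Us: "transpose U = U" using U by (simp add: pos_def_def)
  note GU = matrix_inv_right_left[OF pos_def_invertible[OF G], folded U_eq]

  have TX: "T ** X = mat 1"
    using CiC by (simp add: T_def C_eq matrix_mul_assoc)
  have NX: "N ** X = 0"
    using TX by (simp add: N_def matrix_diff_distrib flip: matrix_mul_assoc)
  have TN: "T ** N = 0"
    using TX by (simp add: N_def matrix_diff_distrib matrix_mul_assoc)
  have NN: "N ** N = N"
    using NX by (subst (2) N_def) (simp add: matrix_diff_distrib matrix_mul_assoc)
  \<comment> \<open>X T = X C^{-1} X' P is self-adjoint for the inner product of
    \<open>P\<close>.\<close>
  have PN: "transpose N ** P = P ** N"
    by (simp add: N_def matrix_diff_distrib T_def matrix_transpose_mul Ps Cis transpose_transpose
        matrix_mul_assoc transpose_mat transpose_diff)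
  have NPN: "transpose N ** P ** N = transpose N ** P"
    unfolding PN using NN by (simp flip: matrix_mul_assoc)
  \<comment> \<open>The trace of X T equals that of T X, the identity of size p.\<close>
  have trN: "trace N = m"
    unfolding N_def trace_sub trace_mul_sym[of X T] TX assms(12) by (simp add: trace_I)
  have NB: "N ** B = 0" and NB0: "N ** B0 = 0"
    using NX by (simp_all add: B_def B0_def matrix_mul_assoc)
  have LB: "L ** B = H ** Ci ** W ** J"
  proof -
    have "L ** B = H ** (T ** X) ** Ci ** W ** J" by (simp only: L_def B_def matrix_mul_assoc)
    then show ?thesis by (simp add: TX)
  qed
  have LB0: "L ** B0 = mat 1"
  proof -
    have "L ** B0 = H ** (T ** X) ** Ci ** transpose H ** U" by (simp only: L_def B0_def matrix_mul_assoc)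
    then show ?thesis using GU(1) by (simp add: TX G_def)
  qed
  have LN: "L ** N = 0" using TN by (simp add: L_def flip: matrix_mul_assoc)
  have JB: "transpose J ** W ** J = U ** (L ** B)"
    by (simp add: LB J_def matrix_transpose_mul Us Cis transpose_transpose matrix_mul_assoc)

  interpret S: shrinkage P N v0 L U B0
    by unfold_locales (fact P U NN LN NPN NB0 LB0 assms(11))+

  note forms = restricted_forms[OF assms(14) _ _ assms(15,16,17) assms(19)[unfolded assms(18)], folded U_def C_def, folded Ci_def,
      folded G_def, OF pos_def_invertible[OF G] U_eq J_def]
  have \<tau>: "trace (L ** B) = \<tau>" unfolding LB \<tau>_def by (rule forms(1))
  have A: "pos_def A"
  proof -
    have R: "transpose R = R" "pos_def R" using assms(14) by (auto simp: is_inv_sqrt_def pos_def_def)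
    have "A = transpose (R ** transpose Q) ** W ** (R ** transpose Q)"
      unfolding assms(18) matrix_transpose_mul transpose_transpose R by (simp only: matrix_mul_assoc)
    moreover have "x = 0" if "(R ** transpose Q) *v x = 0" for x
    proof -
      have "(Q ** matrix_inv R) *v ((R ** transpose Q) *v x) = (Q ** (matrix_inv R ** R) ** transpose Q) *v x"
        by (simp only: matrix_vector_mul_assoc matrix_mul_assoc)
      also have "\<dots> = x"
        using assms(16) by (simp add: matrix_inv_right_left(2)[OF pos_def_invertible[OF R(2)]] orthogonal_matrix_def)
      finally show ?thesis using that by simp
    qed
    ultimately show ?thesis using pos_def_congruence[OF assms(10)] by metis
  qed
  have A11: "pos_def A11" unfolding assms(19) by (rule pos_def_lead_block[OF assms(15) A])
  have \<tau>_pos: "\<tau> > 0" unfolding \<tau>_def by (rule pos_def_trace_pos[OF A11])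
  have bound: "(q + 2) * (z \<bullet> (A11 *v z)) \<le> 2 * \<tau> * (z \<bullet> z)" for z
  proof -
    let ?e = "max_eigenvalue A11"
    have ev: "z \<bullet> (A11 *v z) \<le> ?e * (z \<bullet> z)" for z
      using max_eigenvalue_upper_bound[of A11 z] A11 by (simp add: pos_def_def power2_norm_eq_inner)
    \<comment> \<open>Any unit vector would do: it shows that the largest eigenvalue is positive, so
      the quotient in the hypothesis can be multiplied out.\<close>
    define z1 :: "real^'q" where "z1 = axis undefined 1"
    have "z1 \<bullet> (A11 *v z1) > 0" using A11 unfolding pos_def_def z1_def by (metis axis_eq_0_iff zero_neq_one)
    then have "?e > 0" using ev[of z1] by (simp add: z1_def inner_axis_axis)
    then have "(q + 2) * ?e \<le> 2 * \<tau>" using assms(20) by (simp add: q_def \<tau>_def field_simps)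
    then have "(q + 2) * ?e * (z \<bullet> z) \<le> 2 * \<tau> * (z \<bullet> z)" by (intro mult_right_mono) auto
    moreover have "(q + 2) * (z \<bullet> (A11 *v z)) \<le> (q + 2) * (?e * (z \<bullet> z))"
      using ev[of z] q by (intro mult_left_mono) auto
    ultimately show ?thesis by simp
  qed
  have Jform: "y \<bullet> ((transpose J ** W ** J) *v y) = (J *v y) \<bullet> (W *v (J *v y))" for y
    by (simp add: inner_matrix_transpose matrix_vector_mul_assoc matrix_mul_assoc)
  have Zform: "y \<bullet> (Z *v y) = 2 * \<tau> * (y \<bullet> (U *v y)) - (q + 2) * ((J *v y) \<bullet> (W *v (J *v y)))" for y
    unfolding Jform[symmetric] Z_def
    by (simp add: matrix_vector_mult_diff_rdistrib inner_diff_right flip: scaleR_matrix_vector_assoc)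
  have Zs: "transpose Z = Z"
    by (simp add: Z_def transpose_diff transpose_scalar Us matrix_transpose_mul Ws transpose_transpose matrix_mul_assoc)
  have Zpsd: "y \<bullet> (Z *v y) \<ge> 0" for y
    using forms(2)[of y] bound unfolding Zform by auto
  have Z0: "Z \<noteq> 0"
  proof
    have tr: "trace (a *\<^sub>R M) = a * trace M" for a and M :: "real^'q^'q"
      by (simp add: trace_def sum_distrib_left)
    \<comment> \<open>Multiplication by \<open>G\<close>, the inverse of \<open>U\<close>, and
      taking traces would give 2 \<tau> q = (q + 2) \<tau>, hence q = 2 because \<tau> > 0.\<close>
    assume "Z = 0"
    then have "(2 * \<tau>) *\<^sub>R U = (q + 2) *\<^sub>R (U ** (L ** B))" by (simp add: Z_def JB)
    then have "(2 * \<tau>) *\<^sub>R (G ** U) = (q + 2) *\<^sub>R ((G ** U) ** (L ** B))"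
      using scaleR_matrix_mult[of 1 G _ U] scaleR_matrix_mult[of 1 G _ "U ** (L ** B)"]
      by (metis matrix_mul_assoc mult_1 scaleR_one)
    then have "trace ((2 * \<tau>) *\<^sub>R (mat 1 :: real^'q^'q)) = trace ((q + 2) *\<^sub>R (L ** B))" unfolding GU by simp
    then have "2 * \<tau> * q = (q + 2) * \<tau>"
      unfolding tr \<tau> by (simp add: trace_I q_def)
    then show False using \<tau>_pos q by (simp add: algebra_simps)
  qed
  have bil: "S.bil B x = (J *v S.v x) \<bullet> (W *v (J *v S.v x))" for x
  proof -
    have "S.bil B x = S.v x \<bullet> ((U ** (L ** B)) *v S.v x)"
      unfolding S.bil_def inner_matrix_transpose Us by (simp add: matrix_vector_mul_assoc)
    then show ?thesis unfolding JB[symmetric] Jform .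
  qed
  have s: "S.s B x = (T *v x) \<bullet> (W *v (J *v S.v x))" for x
  proof -
    have "P ** B = transpose T ** W ** J"
      by (simp add: B_def T_def matrix_transpose_mul Ps Cis transpose_transpose matrix_mul_assoc)
    then have PB: "P *v (B *v y) = transpose T *v (W *v (J *v y))" for y
      by (simp add: matrix_vector_mul_assoc matrix_mul_assoc)
    have "S.s B x = (P *v (B *v S.v x)) \<bullet> x"
      unfolding S.s_def inner_symmetric_matrix[OF Ps] ..
    also have "\<dots> = (W *v (J *v S.v x)) \<bullet> (T *v x)"
      unfolding PB inner_matrix_transpose[of "transpose T"] transpose_transpose ..
    finally show ?thesis by (simp only: inner_commute[of "T *v x"])
  qed

  let ?f = "elliptical_density V \<sigma> g"
  note em = assms(3) P_def \<sigma> assms(4,6,7)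
  have gain: "(\<integral>x. S.risk_gain c B x * ?f x \<partial>lborel) > 0"
  proof (rule S.risk_gain_pos[OF assms(3) P_def \<sigma> assms(4) _ assms(6,7) NB _ _ Zs Zpsd Z0])
    show "0 \<le> elliptical_density V \<sigma> g x" for x by (rule elliptical_density_nonneg[OF assms(3,5)])
    show "0 < trace N" "c = (real CARD('q) - 2) / (trace N + 2)" using m by (simp_all add: trN c_def q_def)
    show "S.v x \<bullet> (Z *v S.v x) = 2 * trace (L ** B) * S.ell x - (real CARD('q) + 2) * S.bil B x" for x
      unfolding Zform \<tau> bil S.ell_def q_def by simp
  qed

  have bt: "beta_tilde X V (X *v \<beta> + x) = \<beta> + T *v x" for x
  proof -
    have "beta_tilde X V y = T *v y" for y by (simp add: beta_tilde_def T_def Ci_def C_def P_def)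
    then show ?thesis using TX by (simp add: matrix_vector_right_distrib matrix_vector_mul_assoc)
  qed
  have vS: "H *v (\<beta> + T *v x) - h = S.v x" for x
    unfolding S.v_def by (simp add: v0_def L_def matrix_vector_right_distrib matrix_vector_mul_assoc)
  have lossT: "quad_loss W (beta_tilde X V (X *v \<beta> + x)) \<beta> = (T *v x) \<bullet> (W *v (T *v x))" for x
    by (simp add: quad_loss_def bt)
  have lossS: "quad_loss W (beta_S d X V H h (X *v \<beta> + x)) \<beta>
      = quad_loss W (beta_tilde X V (X *v \<beta> + x)) \<beta> - S.risk_gain c B x" for x
  proof -
    let ?y = "X *v \<beta> + x"
    have "?y - X *v beta_tilde X V ?y = N *v x"
      by (simp add: bt N_def matrix_vector_right_distrib matrix_vector_mult_diff_rdistrib matrix_vector_mul_assoc)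
    then have S2: "S2 X V ?y = S.r x / m"
      unfolding S.r_def by (simp add: S2_def Let_def assms(12) P_def)
    have Ln: "Ln X V H h ?y = S.ell x / (q * (S.r x / m))"
      unfolding Ln_def Let_def bt vS S2 q_def S.ell_def by (simp only: U_def)
    \<comment> \<open>The factor m / q in \<open>d\<close> cancels the normalizations inside
      \<open>S2\<close> and \<open>Ln\<close>. When \<open>r\<close> or \<open>ell\<close> vanishes
      both sides are 0 by the division convention, so the loss identity holds for every
      error.\<close>
    have k: "d * inverse (Ln X V H h ?y) = c * (S.r x / S.ell x)"
      unfolding Ln assms(13) c_def q_def[symmetric] using m q by simp
    have diff: "beta_tilde X V ?y - beta_hat X V H h ?y = J *v S.v x"
      by (simp add: beta_hat_def bt vS J_def U_def Ci_def C_def)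
    have "beta_S d X V H h ?y - \<beta> = T *v x - (c * (S.r x / S.ell x)) *\<^sub>R (J *v S.v x)"
      unfolding beta_S_def k diff by (simp add: bt)
    then have "quad_loss W (beta_S d X V H h ?y) \<beta> = (T *v x) \<bullet> (W *v (T *v x))
       - (2 * (c * (S.r x / S.ell x)) * S.s B x - (c * (S.r x / S.ell x))\<^sup>2 * S.bil B x)"
      unfolding quad_loss_def s bil by (simp only: quad_form_diff[OF Ws])
    then show ?thesis
      unfolding lossT S.risk_gain_def by (simp add: power_mult_distrib power_divide)
  qed

  have pbT: "poly_bounded (\<lambda>x. (T *v x) \<bullet> (W *v (T *v x)))"
    by (intro poly_bounded_inner poly_bounded_matrix_nth poly_bounded_mult_nth)
  then have mT: "(\<lambda>x. (T *v x) \<bullet> (W *v (T *v x))) \<in> borel_measurable borel"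
    unfolding poly_bounded_def by (auto intro: borel_measurable_continuous_onI)
  have iT: "integrable lborel (\<lambda>x. (T *v x) \<bullet> (W *v (T *v x)) * ?f x)"
  proof -
    obtain K1 where K1: "K1 \<ge> 0" "\<And>x. norm (T *v x) \<le> K1 * norm x" using matrix_vector_mult_norm_bound[of T] by blast
    obtain K2 where K2: "K2 \<ge> 0" "\<And>x. norm (W *v x) \<le> K2 * norm x" using matrix_vector_mult_norm_bound[of W] by blast
    \<comment> \<open>The loss of \<open>beta_tilde\<close> is at most a multiple of |x|^2; adding
      r^2 / ell only brings it into the form of the common majorant.\<close>
    have "\<bar>(T *v x) \<bullet> (W *v (T *v x))\<bar> \<le> (K1\<^sup>2 * K2) * ((norm x)\<^sup>2 + (S.r x)\<^sup>2 / S.ell x)" for x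
    proof -
      have "\<bar>(T *v x) \<bullet> (W *v (T *v x))\<bar> \<le> norm (T *v x) * norm (W *v (T *v x))" by (rule Cauchy_Schwarz_ineq2)
      also have "\<dots> \<le> norm (T *v x) * (K2 * norm (T *v x))" by (intro mult_left_mono K2) auto
      also have "\<dots> \<le> (K1 * norm x) * (K2 * (K1 * norm x))"
        using K1 K2 by (intro mult_mono) auto
      also have "\<dots> = (K1\<^sup>2 * K2) * (norm x)\<^sup>2" by (simp add: power2_eq_square)
      also have "\<dots> \<le> (K1\<^sup>2 * K2) * ((norm x)\<^sup>2 + (S.r x)\<^sup>2 / S.ell x)"
        using K2(1) S.ell_nonneg[of x] by (intro mult_left_mono) auto
      finally show ?thesis .
    qed
    then show ?thesis by (rule S.elliptical_integrable[OF em mT])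
  qed
  obtain K where K: "\<And>x. \<bar>S.risk_gain c B x\<bar> \<le> K * ((norm x)\<^sup>2 + (S.r x)\<^sup>2 / S.ell x)"
    using S.risk_gain_bound by blast
  have iG: "integrable lborel (\<lambda>x. S.risk_gain c B x * ?f x)"
    by (rule S.elliptical_integrable[OF em S.measurable_risk_gain K])
  have mS: "(\<lambda>x. (T *v x) \<bullet> (W *v (T *v x)) - S.risk_gain c B x) \<in> borel_measurable borel"
    by (intro borel_measurable_diff mT S.measurable_risk_gain)
  note ell = integrable_elliptical_iff[OF assms(3,5,4)] integral_elliptical_eq[OF assms(3,5,4)]
  have "finite_risk W X V g (beta_tilde X V) \<beta> \<sigma>"
    unfolding finite_risk_def lossT ell(1)[OF mT] by (rule iT)
  moreover have "finite_risk W X V g (beta_S d X V H h) \<beta> \<sigma>"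
    unfolding finite_risk_def lossS lossT ell(1)[OF mS] left_diff_distrib
    by (rule Bochner_Integration.integrable_diff[OF iT iG])
  moreover have "risk W X V g (beta_tilde X V) \<beta> \<sigma> - risk W X V g (beta_S d X V H h) \<beta> \<sigma>
      = (\<integral>x. S.risk_gain c B x * ?f x \<partial>lborel)"
    unfolding risk_def lossS lossT ell(2)[OF mT] ell(2)[OF mS] left_diff_distrib
      Bochner_Integration.integral_diff[OF iT iG] by simp
  ultimately show "finite_risk W X V g (beta_tilde X V) \<beta> \<sigma> \<and>
      finite_risk W X V g (beta_S d X V H h) \<beta> \<sigma> \<and>
      risk W X V g (beta_tilde X V) \<beta> \<sigma> - risk W X V g (beta_S d X V H h) \<beta> \<sigma> > 0"
    using gain by simp
qed

end
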